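(* Let $n\ge1$, let $q\in\mathbb{C}$ be nonzero, and let $\Omega^1$ be an $\mathcal{A}_q(n)$-bimodule with basis elements $\mathsf{d}x_1,\dots,\mathsf{d}x_n$ (i.e. $\Omega^1$ is free as a right $\mathcal{A}_q(n)$-module on these elements) whose relations with the generators $x_1,\dots,x_n$ are $$x_i\,\mathsf{d}x_j=\eta(\varepsilon_i,\varepsilon_j)\,\mathsf{d}x_j\,x_i,\qquad i,j=1,\dots,n.$$ If a mapping $\mathsf{d}:\mathcal{A}_q(n)\to\Omega^1$ is defined by $$\mathsf{d}(f)=\mathsf{d}x_1\,\partial_1(f)+\cdots+\mathsf{d}x_n\,\partial_n(f),$$ then the pair $(\Omega^1,\mathsf{d})$ is a first order differential calculus on $\mathcal{A}_q(n)$.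
   Context: The ground field is $\mathbb{C}$. For $\alpha,\beta\in\mathbb{Z}^n$ put $\alpha\ast\beta=\sum_{j=1}^{n-1}\sum_{i>j}(j-i)\alpha_i\beta_j$ and $\eta(\alpha,\beta)=q^{\alpha\ast\beta-\beta\ast\alpha}$. Let $\varepsilon_1,\dots,\varepsilon_n$ be the standard basis of $\mathbb{Z}^n$; then $\eta(\varepsilon_i,\varepsilon_j)=q^{j-i}$. The quantum $n$-space $\mathcal{A}_q(n)$ is the unital associative $\mathbb{C}$-algebra generated by $x_1,\dots,x_n$ subject to the relations $x_ix_j=\eta(\varepsilon_i,\varepsilon_j)\,x_jx_i$ for $1\le i,j\le n$; it has the vector space basis of ordered monomials $x^\alpha=x_1^{\alpha_1}\cdots x_n^{\alpha_n}$, $\alpha\in\mathbb{Z}_{\ge0}^n$, with the convention $x^\alpha=0$ for $\alpha\notin\mathbb{Z}_{\ge 0}^n$. For $i=1,\dots,n$ the linear map $\partial_i:\mathcal{A}_q(n)\to\mathcal{A}_q(n)$ is defined by $$\partial_i(x^\alpha)=\eta\big((\alpha_1,\dots,\alpha_{i-1},0,\dots,0),\varepsilon_i\big)\,\alpha_i\,x^{\alpha-\varepsilon_i}$$ (for $i=1$ the first argument of $\eta$ is $0$). A first order differential calculus over an algebra $\mathcal{A}$ is a pair $(\Omega^1,\mathsf{d})$ where $\Omega^1$ is an $\mathcal{A}$-bimodule and $\mathsf{d}:\mathcal{A}\to\Omega^1$ is a linear map satisfying the Leibniz rule $\mathsf{d}(ab)=\mathsf{d}(a)b+a\,\mathsf{d}(b)$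 for all $a,b\in\mathcal{A}$, and $\Omega^1$ is the linear span of the elements $a\,\mathsf{d}(b)$ (equivalently of the elements $\mathsf{d}(a')b'$), with $a,b,a',b'\in\mathcal{A}$. *)

theory Defs
  imports
    Complex_Main
    "HOL-Library.Poly_Mapping"
    "HOL-Library.FuncSet"
    "HOL-Algebra.Algebra"
    "HOL-Algebra.Algebraic_Closure_Type"
begin

section \<open>Complex algebras, bimodules and first order differential calculi\<close>

abbreviation complex_field :: "complex ring"  (\<open>\<bbbC>\<close>)
  where "\<bbbC> \<equiv> ring_of_type_algebra"

text \<open>
  The locale \<^locale>\<open>algebra\<close> of HOL-Algebra requires commutative multiplication, and
  \<^locale>\<open>module\<close> a commutative base ring, so unital associative algebras and
  bimodules over them are introduced here.
\<close>

locale complex_algebra = module \<bbbC> A + ring A for A (structure) +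
  assumes smult_mult_left: "\<lbrakk>c \<in> carrier \<bbbC>; a \<in> carrier A; b \<in> carrier A\<rbrakk>
      \<Longrightarrow> (c \<odot> a) \<otimes> b = c \<odot> (a \<otimes> b)"
    and smult_mult_right: "\<lbrakk>c \<in> carrier \<bbbC>; a \<in> carrier A; b \<in> carrier A\<rbrakk>
      \<Longrightarrow> a \<otimes> (c \<odot> b) = c \<odot> (a \<otimes> b)"

text \<open>
  As for \<^typ>\<open>('a, 'b) module\<close>, the inherited fields for a multiplication and a unit
  of \<^typ>\<open>'m\<close> carry no meaning.
\<close>

record ('k, 'a, 'm) bimodule = "('k, 'm) module" +
  lact :: "'a \<Rightarrow> 'm \<Rightarrow> 'm"  (infixr \<open>\<triangleright>\<index>\<close> 70)
  ract :: "'m \<Rightarrow> 'a \<Rightarrow> 'm"  (infixl \<open>\<triangleleft>\<index>\<close> 70)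

locale complex_bimodule = A?: complex_algebra A + M?: module \<bbbC> \<Omega>
  for A :: "(complex, 'a, 'r) module_scheme" (structure)
    and \<Omega> :: "(complex, 'a, 'm, 's) bimodule_scheme" (structure) +
  assumes lact_closed: "\<lbrakk>a \<in> carrier A; u \<in> carrier \<Omega>\<rbrakk> \<Longrightarrow> a \<triangleright>\<^bsub>\<Omega>\<^esub> u \<in> carrier \<Omega>"
    and lact_add_left: "\<lbrakk>a \<in> carrier A; b \<in> carrier A; u \<in> carrier \<Omega>\<rbrakk>
      \<Longrightarrow> (a \<oplus>\<^bsub>A\<^esub> b) \<triangleright>\<^bsub>\<Omega>\<^esub> u = (a \<triangleright>\<^bsub>\<Omega>\<^esub> u) \<oplus>\<^bsub>\<Omega>\<^esub> (b \<triangleright>\<^bsub>\<Omega>\<^esub> u)"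
    and lact_add_right: "\<lbrakk>a \<in> carrier A; u \<in> carrier \<Omega>; v \<in> carrier \<Omega>\<rbrakk>
      \<Longrightarrow> a \<triangleright>\<^bsub>\<Omega>\<^esub> (u \<oplus>\<^bsub>\<Omega>\<^esub> v) = (a \<triangleright>\<^bsub>\<Omega>\<^esub> u) \<oplus>\<^bsub>\<Omega>\<^esub> (a \<triangleright>\<^bsub>\<Omega>\<^esub> v)"
    and lact_mult: "\<lbrakk>a \<in> carrier A; b \<in> carrier A; u \<in> carrier \<Omega>\<rbrakk>
      \<Longrightarrow> (a \<otimes>\<^bsub>A\<^esub> b) \<triangleright>\<^bsub>\<Omega>\<^esub> u = a \<triangleright>\<^bsub>\<Omega>\<^esub> (b \<triangleright>\<^bsub>\<Omega>\<^esub> u)"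
    and lact_one: "u \<in> carrier \<Omega> \<Longrightarrow> \<one>\<^bsub>A\<^esub> \<triangleright>\<^bsub>\<Omega>\<^esub> u = u"
    and lact_smult: "\<lbrakk>c \<in> carrier \<bbbC>; a \<in> carrier A; u \<in> carrier \<Omega>\<rbrakk>
      \<Longrightarrow> (c \<odot>\<^bsub>A\<^esub> a) \<triangleright>\<^bsub>\<Omega>\<^esub> u = c \<odot>\<^bsub>\<Omega>\<^esub> (a \<triangleright>\<^bsub>\<Omega>\<^esub> u)"
    and ract_closed: "\<lbrakk>u \<in> carrier \<Omega>; a \<in> carrier A\<rbrakk> \<Longrightarrow> u \<triangleleft>\<^bsub>\<Omega>\<^esub> a \<in> carrier \<Omega>"
    and ract_add_left: "\<lbrakk>u \<in> carrier \<Omega>; v \<in> carrier \<Omega>; a \<in> carrier A\<rbrakk>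
      \<Longrightarrow> (u \<oplus>\<^bsub>\<Omega>\<^esub> v) \<triangleleft>\<^bsub>\<Omega>\<^esub> a = (u \<triangleleft>\<^bsub>\<Omega>\<^esub> a) \<oplus>\<^bsub>\<Omega>\<^esub> (v \<triangleleft>\<^bsub>\<Omega>\<^esub> a)"
    and ract_add_right: "\<lbrakk>u \<in> carrier \<Omega>; a \<in> carrier A; b \<in> carrier A\<rbrakk>
      \<Longrightarrow> u \<triangleleft>\<^bsub>\<Omega>\<^esub> (a \<oplus>\<^bsub>A\<^esub> b) = (u \<triangleleft>\<^bsub>\<Omega>\<^esub> a) \<oplus>\<^bsub>\<Omega>\<^esub> (u \<triangleleft>\<^bsub>\<Omega>\<^esub> b)"
    and ract_mult: "\<lbrakk>u \<in> carrier \<Omega>; a \<in> carrier A; b \<in> carrier A\<rbrakk>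
      \<Longrightarrow> u \<triangleleft>\<^bsub>\<Omega>\<^esub> (a \<otimes>\<^bsub>A\<^esub> b) = (u \<triangleleft>\<^bsub>\<Omega>\<^esub> a) \<triangleleft>\<^bsub>\<Omega>\<^esub> b"
    and ract_one: "u \<in> carrier \<Omega> \<Longrightarrow> u \<triangleleft>\<^bsub>\<Omega>\<^esub> \<one>\<^bsub>A\<^esub> = u"
    and ract_smult: "\<lbrakk>c \<in> carrier \<bbbC>; u \<in> carrier \<Omega>; a \<in> carrier A\<rbrakk>
      \<Longrightarrow> u \<triangleleft>\<^bsub>\<Omega>\<^esub> (c \<odot>\<^bsub>A\<^esub> a) = c \<odot>\<^bsub>\<Omega>\<^esub> (u \<triangleleft>\<^bsub>\<Omega>\<^esub> a)"
    and lact_ract: "\<lbrakk>a \<in> carrier A; u \<in> carrier \<Omega>; b \<in> carrier A\<rbrakk>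
      \<Longrightarrow> (a \<triangleright>\<^bsub>\<Omega>\<^esub> u) \<triangleleft>\<^bsub>\<Omega>\<^esub> b = a \<triangleright>\<^bsub>\<Omega>\<^esub> (u \<triangleleft>\<^bsub>\<Omega>\<^esub> b)"

definition linear_map ::
  "(complex, 'v, 'r) module_scheme \<Rightarrow> (complex, 'w, 's) module_scheme \<Rightarrow> ('v \<Rightarrow> 'w) \<Rightarrow> bool"
  where "linear_map V W f \<longleftrightarrow>
    f \<in> carrier V \<rightarrow> carrier W \<and>
    (\<forall>u\<in>carrier V. \<forall>v\<in>carrier V. f (u \<oplus>\<^bsub>V\<^esub> v) = f u \<oplus>\<^bsub>W\<^esub> f v) \<and>
    (\<forall>c\<in>carrier \<bbbC>. \<forall>v\<in>carrier V. f (c \<odot>\<^bsub>V\<^esub> v) = c \<odot>\<^bsub>W\<^esub> f v)"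

definition linear_span :: "(complex, 'v, 'r) module_scheme \<Rightarrow> 'v set \<Rightarrow> 'v set"
  where "linear_span V S = \<Inter>{U. submodule U \<bbbC> V \<and> S \<subseteq> U}"

definition first_order_differential_calculus ::
  "(complex, 'a, 'r) module_scheme \<Rightarrow> (complex, 'a, 'm, 's) bimodule_scheme \<Rightarrow> ('a \<Rightarrow> 'm) \<Rightarrow> bool"
  where "first_order_differential_calculus A \<Omega> d \<longleftrightarrow>
    complex_bimodule A \<Omega> \<and>
    linear_map A \<Omega> d \<and>
    (\<forall>a\<in>carrier A. \<forall>b\<in>carrier A.
       d (a \<otimes>\<^bsub>A\<^esub> b) = (d a \<triangleleft>\<^bsub>\<Omega>\<^esub> b) \<oplus>\<^bsub>\<Omega>\<^esub> (a \<triangleright>\<^bsub>\<Omega>\<^esub> d b)) \<and>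
    linear_span \<Omega> {a \<triangleright>\<^bsub>\<Omega>\<^esub> d b | a b. a \<in> carrier A \<and> b \<in> carrier A} = carrier \<Omega>"

text \<open>The index set \<open>I\<close> is meant to be finite.\<close>

definition right_module_basis ::
  "('k, 'a, 'r) module_scheme \<Rightarrow> ('k, 'a, 'm, 's) bimodule_scheme \<Rightarrow> 'i set \<Rightarrow> ('i \<Rightarrow> 'm) \<Rightarrow> bool"
  where "right_module_basis A \<Omega> I e \<longleftrightarrow>
    e \<in> I \<rightarrow> carrier \<Omega> \<and>
    (\<forall>u\<in>carrier \<Omega>. \<exists>!a. a \<in> I \<rightarrow>\<^sub>E carrier A \<and> u = (\<Oplus>\<^bsub>\<Omega>\<^esub>i\<in>I. e i \<triangleleft>\<^bsub>\<Omega>\<^esub> a i))"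


section \<open>The free algebra\<close>

text \<open>
  Words form a monoid under concatenation, so that the convolution product of
  \<^typ>\<open>'i list \<Rightarrow>\<^sub>0 complex\<close> is the product of noncommutative polynomials.
\<close>

instantiation list :: (type) monoid_add
begin

definition zero_list :: "'a list" where "zero_list = []"

definition plus_list :: "'a list \<Rightarrow> 'a list \<Rightarrow> 'a list" where "plus_list = (@)"

instance
  by standard (simp_all add: zero_list_def plus_list_def)

end

type_synonym ncpoly = "nat list \<Rightarrow>\<^sub>0 complex"

definition nc_const :: "complex \<Rightarrow> ncpoly"
  where "nc_const c = Poly_Mapping.single [] c"

definition nc_var :: "nat \<Rightarrow> ncpoly"
  where "nc_var i = Poly_Mapping.single [i] 1"

text \<open>The free algebra on letters \<open>1, \<dots>, n\<close>.\<close>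

definition free_algebra :: "nat \<Rightarrow> (complex, ncpoly) module"
  where "free_algebra n =
    \<lparr>carrier = {p. Poly_Mapping.keys p \<subseteq> lists {1..n}},
     monoid.mult = (*), one = 1, ring.zero = 0, add = (+),
     module.smult = (\<lambda>c p. nc_const c * p)\<rparr>"

definition quotient_algebra :: "('k, 'a, 'r) module_scheme \<Rightarrow> 'a set \<Rightarrow> ('k, 'a set) module"
  where "quotient_algebra A I =
    \<lparr>carrier = carrier (A Quot I), monoid.mult = monoid.mult (A Quot I),
     one = one (A Quot I), ring.zero = ring.zero (A Quot I), add = add (A Quot I),
     module.smult = (\<lambda>c Y. (I +>\<^bsub>A\<^esub> (c \<odot>\<^bsub>A\<^esub> \<one>\<^bsub>A\<^esub>)) \<otimes>\<^bsub>A Quot I\<^esub> Y)\<rparr>"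


section \<open>Quantum space\<close>

text \<open>
  Elements of the lattice of rank \<open>n\<close> are functions \<^typ>\<open>nat \<Rightarrow> int\<close> of which only the
  values at \<open>1, \<dots>, n\<close> matter.
\<close>

definition star :: "nat \<Rightarrow> (nat \<Rightarrow> int) \<Rightarrow> (nat \<Rightarrow> int) \<Rightarrow> int"
  where "star n \<alpha> \<beta> = (\<Sum>j=1..n-1. \<Sum>i=j+1..n. (int j - int i) * \<alpha> i * \<beta> j)"

definition eta :: "nat \<Rightarrow> complex \<Rightarrow> (nat \<Rightarrow> int) \<Rightarrow> (nat \<Rightarrow> int) \<Rightarrow> complex"
  where "eta n q \<alpha> \<beta> = q powi (star n \<alpha> \<beta> - star n \<beta> \<alpha>)"

definition unit_vec :: "nat \<Rightarrow> nat \<Rightarrow> int"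
  where "unit_vec i = (\<lambda>k. if k = i then 1 else 0)"

definition quantum_relators :: "nat \<Rightarrow> complex \<Rightarrow> ncpoly set"
  where "quantum_relators n q =
    {nc_var i * nc_var j - nc_const (eta n q (unit_vec i) (unit_vec j)) * (nc_var j * nc_var i)
      | i j. i \<in> {1..n} \<and> j \<in> {1..n}}"

definition quantum_ideal :: "nat \<Rightarrow> complex \<Rightarrow> ncpoly set"
  where "quantum_ideal n q = genideal (free_algebra n) (quantum_relators n q)"

definition quantum_space :: "nat \<Rightarrow> complex \<Rightarrow> (complex, ncpoly set) module"
  where "quantum_space n q = quotient_algebra (free_algebra n) (quantum_ideal n q)"

definition quantum_gen :: "nat \<Rightarrow> complex \<Rightarrow> nat \<Rightarrow> ncpoly set"
  where "quantum_gen n q i = quantum_ideal n q +>\<^bsub>free_algebra n\<^esub> nc_var i"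

text \<open>
  The ordered monomial \<open>x\<^sub>1\<^bsup>\<alpha> 1\<^esup> \<cdots> x\<^sub>n\<^bsup>\<alpha> n\<^esup>\<close>; it is zero
  if some exponent is negative.
\<close>

definition quantum_monomial :: "nat \<Rightarrow> complex \<Rightarrow> (nat \<Rightarrow> int) \<Rightarrow> ncpoly set"
  where "quantum_monomial n q \<alpha> =
    (if \<forall>i\<in>{1..n}. 0 \<le> \<alpha> i
     then foldr (\<lambda>i m. (quantum_gen n q i [^]\<^bsub>quantum_space n q\<^esub> nat (\<alpha> i)) \<otimes>\<^bsub>quantum_space n q\<^esub> m)
            [1..<Suc n] \<one>\<^bsub>quantum_space n q\<^esub>
     else \<zero>\<^bsub>quantum_space n q\<^esub>)"

text \<open>
  The linear map \<open>\<partial>\<^sub>i\<close>, given by its values on the basis of ordered monomials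
  (for \<^term>\<open>q \<noteq> 0\<close>). Membership in \<open>\<rightarrow>\<^sub>E\<close> only fixes the irrelevant values off the carrier.
\<close>

definition quantum_partial :: "nat \<Rightarrow> complex \<Rightarrow> nat \<Rightarrow> ncpoly set \<Rightarrow> ncpoly set"
  where "quantum_partial n q i =
    (THE D. D \<in> carrier (quantum_space n q) \<rightarrow>\<^sub>E carrier (quantum_space n q) \<and>
       linear_map (quantum_space n q) (quantum_space n q) D \<and>
       (\<forall>\<alpha>. (\<forall>j\<in>{1..n}. 0 \<le> \<alpha> j) \<longrightarrow>
          D (quantum_monomial n q \<alpha>) =
            (eta n q (\<lambda>j. if j < i then \<alpha> j else 0) (unit_vec i) * of_int (\<alpha> i))
              \<odot>\<^bsub>quantum_space n q\<^esub> quantum_monomial n q (\<lambda>j. \<alpha> j - unit_vec i j)))"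


section \<open>Quantum space is a complex algebra\<close>

lemma carrier_free_algebra: "p \<in> carrier (free_algebra n) \<longleftrightarrow> Poly_Mapping.keys p \<subseteq> lists {1..n}"
  by (simp add: free_algebra_def)

lemma keys_mult_lists:
  fixes p r :: ncpoly
  assumes "Poly_Mapping.keys p \<subseteq> lists S" "Poly_Mapping.keys r \<subseteq> lists S"
  shows "Poly_Mapping.keys (p * r) \<subseteq> lists S"
proof -
  have "Poly_Mapping.keys (p * r) \<subseteq> {u + v | u v. u \<in> Poly_Mapping.keys p \<and> v \<in> Poly_Mapping.keys r}"
    by (rule keys_mult)
  with assms show ?thesis by (fastforce simp: plus_list_def)
qed

lemma nc_const_carrier: "nc_const c \<in> carrier (free_algebra n)"
  by (simp add: carrier_free_algebra nc_const_def)

lemma nc_var_carrier: "i \<in> {1..n} \<Longrightarrow> nc_var i \<in> carrier (free_algebra n)"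
  by (simp add: carrier_free_algebra nc_var_def)

lemma nc_const_1: "nc_const 1 = 1"
  by (simp add: nc_const_def flip: zero_list_def)
lemma nc_const_add: "nc_const (a + b) = nc_const a + nc_const b"
  by (simp add: nc_const_def single_add)
lemma nc_const_mult: "nc_const (a * b) = nc_const a * nc_const b"
  by (simp add: nc_const_def mult_single plus_list_def)

lemma nc_const_comm: "nc_const c * p = p * nc_const c"
proof (induction p rule: update_induct)
  case const
  then show ?case by simp
next
  case (update f a b)
  have "Poly_Mapping.update a b f = f + Poly_Mapping.single a b"
    using update(1) by (intro poly_mapping_eqI)
      (auto simp: lookup_update lookup_add lookup_single when_def in_keys_iff)
  moreover have "nc_const c * Poly_Mapping.single a b = Poly_Mapping.single a b * nc_const c"
    by (simp add: nc_const_def mult_single plus_list_def mult.commute)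
  ultimately show ?case using update(3) by (simp add: distrib_left distrib_right)
qed

lemma ring_free_algebra: "ring (free_algebra n)"
proof (intro ringI abelian_groupI monoidI; (unfold carrier_free_algebra)?)
  fix x :: ncpoly assume x: "Poly_Mapping.keys x \<subseteq> lists {1..n}"
  show "\<exists>y\<in>carrier (free_algebra n). y \<oplus>\<^bsub>free_algebra n\<^esub> x = \<zero>\<^bsub>free_algebra n\<^esub>"
    using x by (intro bexI[of _ "- x"]) (auto simp: free_algebra_def)
next
  fix x y :: ncpoly assume "Poly_Mapping.keys x \<subseteq> lists {1..n}" "Poly_Mapping.keys y \<subseteq> lists {1..n}"
  then show "Poly_Mapping.keys (x \<oplus>\<^bsub>free_algebra n\<^esub> y) \<subseteq> lists {1..n}"
    using Poly_Mapping.keys_add[of x y] by (auto simp: free_algebra_def)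
next
  fix x y :: ncpoly assume "Poly_Mapping.keys x \<subseteq> lists {1..n}" "Poly_Mapping.keys y \<subseteq> lists {1..n}"
  then show "Poly_Mapping.keys (x \<otimes>\<^bsub>free_algebra n\<^esub> y) \<subseteq> lists {1..n}"
    using keys_mult_lists by (simp add: free_algebra_def)
qed (auto simp: free_algebra_def algebra_simps zero_list_def)

lemma relators_carrier: "quantum_relators n q \<subseteq> carrier (free_algebra n)"
proof -
  have "p - r \<in> carrier (free_algebra n)" 
    if "p \<in> carrier (free_algebra n)" "r \<in> carrier (free_algebra n)" for p r
    using that keys_diff[of p r] by (auto simp: carrier_free_algebra)
  moreover have "p * r \<in> carrier (free_algebra n)" 
    if "p \<in> carrier (free_algebra n)" "r \<in> carrier (free_algebra n)" for p r
    using that by (simp add: carrier_free_algebra keys_mult_lists)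
  ultimately show ?thesis
    by (auto simp: quantum_relators_def nc_const_carrier nc_var_carrier)
qed

lemma ideal_quantum_ideal: "ideal (quantum_ideal n q) (free_algebra n)"
  unfolding quantum_ideal_def by (rule ring.genideal_ideal[OF ring_free_algebra relators_carrier])

lemma complex_algebra_quantum_space: "complex_algebra (quantum_space n q)"
proof -
  let ?F = "free_algebra n" and ?I = "quantum_ideal n q"
  let ?Q = "?F Quot ?I" and ?A = "quantum_space n q"
  let ?k = "\<lambda>c. ?I +>\<^bsub>?F\<^esub> (nc_const c)"
  interpret F: ring ?F by (rule ring_free_algebra)
  interpret I: ideal ?I ?F by (rule ideal_quantum_ideal)
  interpret Q: ring ?Q by (rule I.quotient_is_ring)
  have sel: "carrier ?A = carrier ?Q" "monoid.mult ?A = monoid.mult ?Q" "one ?A = one ?Q"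
      "ring.zero ?A = ring.zero ?Q" "add ?A = add ?Q"
    by (simp_all add: quantum_space_def quotient_algebra_def)
  have sm: "module.smult ?A c Y = ?k c \<otimes>\<^bsub>?Q\<^esub> Y" for c Y
    by (simp add: quantum_space_def quotient_algebra_def free_algebra_def)
  have rA: "ring ?A"
  proof -
    show ?thesis
    proof (intro ringI abelian_groupI monoidI; (unfold sel)?)
      fix Y assume "Y \<in> carrier ?Q"
      then show "\<exists>Z\<in>carrier ?Q. Z \<oplus>\<^bsub>?Q\<^esub> Y = \<zero>\<^bsub>?Q\<^esub>"
        using Q.l_neg Q.a_inv_closed by blast
    qed (simp_all add: Q.m_assoc Q.l_distr Q.r_distr Q.a_ac)
  qed
  have hom: "(+>\<^bsub>?F\<^esub>) ?I \<in> ring_hom ?F ?Q" by (rule I.rcos_ring_hom)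
  note kc = nc_const_carrier[of _ n]
  have kQ: "?k c \<in> carrier ?Q" for c using ring_hom_closed[OF hom kc] .
  have kadd: "?k (a + b) = ?k a \<oplus>\<^bsub>?Q\<^esub> ?k b" for a b
    using ring_hom_add[OF hom kc kc, of a b] by (simp add: nc_const_add free_algebra_def)
  have kmult: "?k (a * b) = ?k a \<otimes>\<^bsub>?Q\<^esub> ?k b" for a b
    using ring_hom_mult[OF hom kc kc, of a b] by (simp add: nc_const_mult free_algebra_def)
  have kone: "?k 1 = \<one>\<^bsub>?Q\<^esub>"
    using ring_hom_one[OF hom] by (simp add: nc_const_1 free_algebra_def)
  have kcomm: "?k c \<otimes>\<^bsub>?Q\<^esub> Y = Y \<otimes>\<^bsub>?Q\<^esub> ?k c" if Y: "Y \<in> carrier ?Q" for c Y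
  proof -
    obtain p where p: "p \<in> carrier ?F" "Y = ?I +>\<^bsub>?F\<^esub> p"
      using Y unfolding FactRing_def A_RCOSETS_def' by auto
    have "nc_const c \<otimes>\<^bsub>?F\<^esub> p = p \<otimes>\<^bsub>?F\<^esub> nc_const c"
      by (simp add: free_algebra_def nc_const_comm)
    then show ?thesis
      using ring_hom_mult[OF hom kc p(1)] ring_hom_mult[OF hom p(1) kc] p(2) by metis
  qed
  show ?thesis
  proof (intro complex_algebra.intro complex_algebra_axioms.intro moduleI)
    show "cring \<bbbC>" by (rule cring_from_type_algebra)
    show "abelian_group ?A" using rA by (simp add: ring_def)
    show "ring ?A" by (rule rA)
  next
    fix c a b assume "a \<in> carrier ?A" "b \<in> carrier ?A"
    then show "a \<otimes>\<^bsub>?A\<^esub> (c \<odot>\<^bsub>?A\<^esub> b) = c \<odot>\<^bsub>?A\<^esub> (a \<otimes>\<^bsub>?A\<^esub> b)"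
      unfolding sel sm using kQ kcomm Q.m_assoc by metis
  qed (auto simp: sel sm kQ kadd kmult kone Q.m_assoc Q.l_distr Q.r_distr ring_of_type_algebra_def)
qed
end

theory Submission
  imports Defs
begin

text \<open>
  Let \<open>\<sigma>\<^sub>i\<close> be the algebra endomorphism with \<open>\<sigma>\<^sub>i(x\<^sub>j) = \<eta>(\<epsilon>\<^sub>j, \<epsilon>\<^sub>i) x\<^sub>j\<close>. The bimodule
  relations say precisely that \<open>f dx\<^sub>i = dx\<^sub>i \<sigma>\<^sub>i(f)\<close>, so that for a map
  \<open>d f = \<Sum>\<^sub>i dx\<^sub>i D\<^sub>i(f)\<close> the Leibniz rule follows from the twisted rule
  \<open>D\<^sub>i(f g) = D\<^sub>i(f) g + \<sigma>\<^sub>i(f) D\<^sub>i(g)\<close>. If moreover \<open>D\<^sub>i(x\<^sub>j)\<close> is the Kronecker symbol, then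
  \<open>d x\<^sub>i = dx\<^sub>i\<close>, and the identity \<open>dx\<^sub>i a = d(x\<^sub>i a) - x\<^sub>i d(a)\<close> shows that the elements
  \<open>a d(b)\<close> span the bimodule. This part holds over any algebra
  (\<open>calculus_of_skew_derivations\<close>).

  It remains to see that \<open>\<partial>\<^sub>i\<close>, which is given by its values on ordered monomials, is such a
  skew derivation. On the free algebra, \<open>\<sigma>\<^sub>i\<close> (\<open>rescale\<close>) and a skew derivation along it with
  Kronecker values on the letters (\<open>skew_partial\<close>) clearly exist. The first multiplies each
  defining relator by a scalar and the second sends it to zero, so both preserve the ideal of
  relations (\<open>skew_partial_rescale_quantum_ideal\<close>) and the skew derivation descends to quantum
  space. On an ordered monomial only the block \<open>x\<^sub>i\<^bsup>\<alpha> i\<^esup>\<close> contributes, and moving past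
  the blocks to its left produces the factor \<open>\<eta>((\<alpha>\<^sub>1, \<dots>, \<alpha>\<^sub>i\<^sub>-\<^sub>1, 0, \<dots>), \<epsilon>\<^sub>i)\<close>; these are
  the values prescribed for \<open>\<partial>\<^sub>i\<close> (\<open>word_partial_blocks\<close>). Ordered monomials span, because
  sorting the letters of a word changes its class by a scalar only (\<open>quantum_proj_sort\<close>), so the
  descended map is the only linear map with these values, that is, \<open>\<partial>\<^sub>i\<close>
  (\<open>quantum_partial_proj_and_linear\<close>).
\<close>

section \<open>First order calculi from skew derivations\<close>

lemma linear_map_add:
  assumes "linear_map V W f" "u \<in> carrier V" "v \<in> carrier V"
  shows "f (u \<oplus>\<^bsub>V\<^esub> v) = f u \<oplus>\<^bsub>W\<^esub> f v"
  using assms unfolding linear_map_def by blast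

lemma linear_map_smult:
  assumes "linear_map V W f" "v \<in> carrier V"
  shows "f (c \<odot>\<^bsub>V\<^esub> v) = c \<odot>\<^bsub>W\<^esub> f v"
proof -
  have "c \<in> carrier \<bbbC>" by (simp add: ring_of_type_algebra_def)
  then show ?thesis using assms unfolding linear_map_def by blast
qed

lemma finsum_additive_map:
  assumes G: "abelian_group G"
    and h: "h \<in> carrier G \<rightarrow> carrier G"
      "\<And>u v. u \<in> carrier G \<Longrightarrow> v \<in> carrier G \<Longrightarrow> h (u \<oplus>\<^bsub>G\<^esub> v) = h u \<oplus>\<^bsub>G\<^esub> h v"
    and "finite I" "f \<in> I \<rightarrow> carrier G"
  shows "h (\<Oplus>\<^bsub>G\<^esub>i\<in>I. f i) = (\<Oplus>\<^bsub>G\<^esub>i\<in>I. h (f i))"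
proof -
  interpret abelian_group G by (rule G)
  have zero: "h \<zero>\<^bsub>G\<^esub> = \<zero>\<^bsub>G\<^esub>"
  proof -
    have "h \<zero>\<^bsub>G\<^esub> \<oplus>\<^bsub>G\<^esub> h \<zero>\<^bsub>G\<^esub> = h \<zero>\<^bsub>G\<^esub>" using h(2)[of "\<zero>\<^bsub>G\<^esub>" "\<zero>\<^bsub>G\<^esub>"] by simp
    moreover have "h \<zero>\<^bsub>G\<^esub> \<in> carrier G" using h(1) by blast
    ultimately show ?thesis by simp
  qed
  from \<open>finite I\<close> \<open>f \<in> I \<rightarrow> carrier G\<close> show ?thesis
  proof (induction I)
    case (insert i I)
    then have f: "f \<in> I \<rightarrow> carrier G" "f i \<in> carrier G" by auto
    then have "(\<lambda>i. h (f i)) \<in> I \<rightarrow> carrier G" "h (f i) \<in> carrier G" using h(1) by auto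
    with insert f show ?case by (simp add: h(2) finsum_closed)
  qed (simp add: zero)
qed

text \<open>
  Moving \<open>a\<close> across \<open>e i\<close> turns the summand \<open>e i \<tau>\<^sub>i(a) D\<^sub>i(b)\<close> of \<open>d(a b)\<close> into
  \<open>a e i D\<^sub>i(b)\<close>, which gives the Leibniz rule summand by summand. For the span,
  \<open>e i = d(x i)\<close> and the Leibniz rule express \<open>e i a\<close> as \<open>d(x i a) - x i d(a)\<close>.
\<close>

lemma (in complex_bimodule) calculus_of_skew_derivations:
  assumes "finite I" and basis: "right_module_basis A \<Omega> I e"
    and \<tau>_closed: "\<And>i a. i \<in> I \<Longrightarrow> a \<in> carrier A \<Longrightarrow> \<tau> i a \<in> carrier A"
    and commute: "\<And>i a. i \<in> I \<Longrightarrow> a \<in> carrier A \<Longrightarrow> a \<triangleright>\<^bsub>\<Omega>\<^esub> e i = e i \<triangleleft>\<^bsub>\<Omega>\<^esub> \<tau> i a"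
    and linear: "\<And>i. i \<in> I \<Longrightarrow> linear_map A A (D i)"
    and skew: "\<And>i a b. i \<in> I \<Longrightarrow> a \<in> carrier A \<Longrightarrow> b \<in> carrier A \<Longrightarrow>
      D i (a \<otimes>\<^bsub>A\<^esub> b) = (D i a \<otimes>\<^bsub>A\<^esub> b) \<oplus>\<^bsub>A\<^esub> (\<tau> i a \<otimes>\<^bsub>A\<^esub> D i b)"
    and x_closed: "\<And>i. i \<in> I \<Longrightarrow> x i \<in> carrier A"
    and dual: "\<And>i j. i \<in> I \<Longrightarrow> j \<in> I \<Longrightarrow> D i (x j) = (if i = j then \<one>\<^bsub>A\<^esub> else \<zero>\<^bsub>A\<^esub>)"
    and d: "\<And>f. f \<in> carrier A \<Longrightarrow> d f = (\<Oplus>\<^bsub>\<Omega>\<^esub>i\<in>I. e i \<triangleleft>\<^bsub>\<Omega>\<^esub> D i f)"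
  shows "first_order_differential_calculus A \<Omega> d"
proof -
  have e: "e i \<in> carrier \<Omega>" if "i \<in> I" for i
    using basis that unfolding right_module_basis_def by blast
  have D_closed: "D i a \<in> carrier A" if "i \<in> I" "a \<in> carrier A" for i a
    using linear that unfolding linear_map_def by blast
  note closed = e D_closed \<tau>_closed x_closed lact_closed ract_closed
  have d_closed: "d a \<in> carrier \<Omega>" if "a \<in> carrier A" for a
    unfolding d[OF that] using that by (intro M.M.finsum_closed) (simp add: closed)
  have d_add: "d (a \<oplus>\<^bsub>A\<^esub> b) = d a \<oplus>\<^bsub>\<Omega>\<^esub> d b" if "a \<in> carrier A" "b \<in> carrier A" for a b
  proof -
    have "d (a \<oplus>\<^bsub>A\<^esub> b) = (\<Oplus>\<^bsub>\<Omega>\<^esub>i\<in>I. (e i \<triangleleft>\<^bsub>\<Omega>\<^esub> D i a) \<oplus>\<^bsub>\<Omega>\<^esub> (e i \<triangleleft>\<^bsub>\<Omega>\<^esub> D i b))"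
      unfolding d[OF A.M.a_closed[OF that]] using that
      by (intro M.M.finsum_cong') (simp_all add: linear_map_add[OF linear] ract_add_right closed)
    also have "\<dots> = d a \<oplus>\<^bsub>\<Omega>\<^esub> d b"
      using that by (subst M.M.finsum_addf) (simp_all add: d closed)
    finally show ?thesis .
  qed
  have d_smult: "d (c \<odot>\<^bsub>A\<^esub> a) = c \<odot>\<^bsub>\<Omega>\<^esub> d a" if "c \<in> carrier \<bbbC>" "a \<in> carrier A" for c a
  proof -
    have "d (c \<odot>\<^bsub>A\<^esub> a) = (\<Oplus>\<^bsub>\<Omega>\<^esub>i\<in>I. c \<odot>\<^bsub>\<Omega>\<^esub> (e i \<triangleleft>\<^bsub>\<Omega>\<^esub> D i a))"
      unfolding d[OF A.smult_closed[OF that]] using that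
      by (intro M.M.finsum_cong') (simp_all add: linear_map_smult[OF linear] ract_smult closed)
    also have "\<dots> = c \<odot>\<^bsub>\<Omega>\<^esub> d a"
      unfolding d[OF that(2)] using that \<open>finite I\<close>
      by (intro M.finsum_smult_ldistr[symmetric]) (simp_all add: closed)
    finally show ?thesis .
  qed
  have leibniz: "d (a \<otimes>\<^bsub>A\<^esub> b) = (d a \<triangleleft>\<^bsub>\<Omega>\<^esub> b) \<oplus>\<^bsub>\<Omega>\<^esub> (a \<triangleright>\<^bsub>\<Omega>\<^esub> d b)"
    if a: "a \<in> carrier A" and b: "b \<in> carrier A" for a b
  proof -
    have "e i \<triangleleft>\<^bsub>\<Omega>\<^esub> D i (a \<otimes>\<^bsub>A\<^esub> b) =
        ((e i \<triangleleft>\<^bsub>\<Omega>\<^esub> D i a) \<triangleleft>\<^bsub>\<Omega>\<^esub> b) \<oplus>\<^bsub>\<Omega>\<^esub> (a \<triangleright>\<^bsub>\<Omega>\<^esub> (e i \<triangleleft>\<^bsub>\<Omega>\<^esub> D i b))" if i: "i \<in> I" for i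
    proof -
      have "a \<triangleright>\<^bsub>\<Omega>\<^esub> (e i \<triangleleft>\<^bsub>\<Omega>\<^esub> D i b) = e i \<triangleleft>\<^bsub>\<Omega>\<^esub> (\<tau> i a \<otimes>\<^bsub>A\<^esub> D i b)"
        using i a b by (simp add: ract_mult closed flip: lact_ract commute)
      then show ?thesis
        using i a b by (simp add: skew ract_add_right ract_mult closed)
    qed
    then have "d (a \<otimes>\<^bsub>A\<^esub> b) =
        (\<Oplus>\<^bsub>\<Omega>\<^esub>i\<in>I. ((e i \<triangleleft>\<^bsub>\<Omega>\<^esub> D i a) \<triangleleft>\<^bsub>\<Omega>\<^esub> b) \<oplus>\<^bsub>\<Omega>\<^esub> (a \<triangleright>\<^bsub>\<Omega>\<^esub> (e i \<triangleleft>\<^bsub>\<Omega>\<^esub> D i b)))"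
      unfolding d[OF A.m_closed[OF a b]] using a b
      by (intro M.M.finsum_cong') (simp_all add: closed)
    also have "\<dots> = (\<Oplus>\<^bsub>\<Omega>\<^esub>i\<in>I. (e i \<triangleleft>\<^bsub>\<Omega>\<^esub> D i a) \<triangleleft>\<^bsub>\<Omega>\<^esub> b) \<oplus>\<^bsub>\<Omega>\<^esub>
        (\<Oplus>\<^bsub>\<Omega>\<^esub>i\<in>I. a \<triangleright>\<^bsub>\<Omega>\<^esub> (e i \<triangleleft>\<^bsub>\<Omega>\<^esub> D i b))"
      using a b by (intro M.M.finsum_addf) (simp_all add: closed)
    also have "(\<Oplus>\<^bsub>\<Omega>\<^esub>i\<in>I. (e i \<triangleleft>\<^bsub>\<Omega>\<^esub> D i a) \<triangleleft>\<^bsub>\<Omega>\<^esub> b) = d a \<triangleleft>\<^bsub>\<Omega>\<^esub> b"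
      unfolding d[OF a] using a b \<open>finite I\<close>
      by (intro finsum_additive_map[OF M.M.abelian_group_axioms, symmetric])
        (simp_all add: closed ract_add_left)
    also have "(\<Oplus>\<^bsub>\<Omega>\<^esub>i\<in>I. a \<triangleright>\<^bsub>\<Omega>\<^esub> (e i \<triangleleft>\<^bsub>\<Omega>\<^esub> D i b)) = a \<triangleright>\<^bsub>\<Omega>\<^esub> d b"
      unfolding d[OF b] using a b \<open>finite I\<close>
      by (intro finsum_additive_map[OF M.M.abelian_group_axioms, symmetric])
        (simp_all add: closed lact_add_right)
    finally show ?thesis .
  qed
  have ract_zero: "u \<triangleleft>\<^bsub>\<Omega>\<^esub> \<zero>\<^bsub>A\<^esub> = \<zero>\<^bsub>\<Omega>\<^esub>" if "u \<in> carrier \<Omega>" for u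
    using ract_add_right[OF that, of "\<zero>\<^bsub>A\<^esub>" "\<zero>\<^bsub>A\<^esub>"] ract_closed[OF that, of "\<zero>\<^bsub>A\<^esub>"] by simp
  have d_x: "d (x i) = e i" if i: "i \<in> I" for i
  proof -
    have "d (x i) = (\<Oplus>\<^bsub>\<Omega>\<^esub>j\<in>I. if i = j then e j else \<zero>\<^bsub>\<Omega>\<^esub>)"
      unfolding d[OF x_closed[OF i]] using i
      by (intro M.M.finsum_cong') (auto simp: dual ract_one ract_zero closed)
    also have "\<dots> = e i"
      using i \<open>finite I\<close> by (intro M.M.finsum_singleton) (simp_all add: closed)
    finally show ?thesis .
  qed
  let ?S = "{a \<triangleright>\<^bsub>\<Omega>\<^esub> d b | a b. a \<in> carrier A \<and> b \<in> carrier A}"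
  have "u \<in> U" if U: "submodule U \<bbbC> \<Omega>" and S: "?S \<subseteq> U" and u: "u \<in> carrier \<Omega>" for u U
  proof -
    note U_closed = M.submoduleE[OF U]
    have adb: "a \<triangleright>\<^bsub>\<Omega>\<^esub> d b \<in> U" if "a \<in> carrier A" "b \<in> carrier A" for a b
      using S that by blast
    have e_in_U: "e i \<triangleleft>\<^bsub>\<Omega>\<^esub> a \<in> U" if i: "i \<in> I" and a: "a \<in> carrier A" for i a
    proof -
      have xa: "x i \<otimes>\<^bsub>A\<^esub> a \<in> carrier A" using i a by (simp add: closed)
      have "d (x i \<otimes>\<^bsub>A\<^esub> a) = (e i \<triangleleft>\<^bsub>\<Omega>\<^esub> a) \<oplus>\<^bsub>\<Omega>\<^esub> (x i \<triangleright>\<^bsub>\<Omega>\<^esub> d a)"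
        using leibniz[OF x_closed[OF i] a] d_x[OF i] by simp
      then have "e i \<triangleleft>\<^bsub>\<Omega>\<^esub> a = d (x i \<otimes>\<^bsub>A\<^esub> a) \<oplus>\<^bsub>\<Omega>\<^esub> (\<ominus>\<^bsub>\<Omega>\<^esub> (x i \<triangleright>\<^bsub>\<Omega>\<^esub> d a))"
        using i a by (simp add: closed d_closed M.M.a_assoc M.M.r_neg)
      also have "d (x i \<otimes>\<^bsub>A\<^esub> a) = \<one>\<^bsub>A\<^esub> \<triangleright>\<^bsub>\<Omega>\<^esub> d (x i \<otimes>\<^bsub>A\<^esub> a)"
        using xa by (simp add: lact_one d_closed)
      finally show ?thesis
        using i a xa by (simp only:) (intro U_closed(3,5) adb x_closed A.one_closed)
    qed
    obtain a where a: "a \<in> I \<rightarrow>\<^sub>E carrier A" and u_eq: "u = (\<Oplus>\<^bsub>\<Omega>\<^esub>i\<in>I. e i \<triangleleft>\<^bsub>\<Omega>\<^esub> a i)"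
      using basis u unfolding right_module_basis_def by blast
    have "J \<subseteq> I \<Longrightarrow> (\<Oplus>\<^bsub>\<Omega>\<^esub>i\<in>J. e i \<triangleleft>\<^bsub>\<Omega>\<^esub> a i) \<in> U" if "finite J" for J
      using that
    proof (induction J)
      case empty
      show ?case using U subgroup.one_closed[of U "add_monoid \<Omega>"] by (simp add: submodule_def)
    next
      case (insert i J)
      then have "(\<Oplus>\<^bsub>\<Omega>\<^esub>i\<in>insert i J. e i \<triangleleft>\<^bsub>\<Omega>\<^esub> a i) =
          (e i \<triangleleft>\<^bsub>\<Omega>\<^esub> a i) \<oplus>\<^bsub>\<Omega>\<^esub> (\<Oplus>\<^bsub>\<Omega>\<^esub>i\<in>J. e i \<triangleleft>\<^bsub>\<Omega>\<^esub> a i)"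
        using a by (intro M.M.finsum_insert) (auto intro!: closed)
      moreover have "e i \<triangleleft>\<^bsub>\<Omega>\<^esub> a i \<in> U" using insert.prems a by (intro e_in_U) auto
      ultimately show ?case using insert U_closed(5) by simp
    qed
    then show ?thesis unfolding u_eq using \<open>finite I\<close> by blast
  qed
  moreover have "?S \<subseteq> carrier \<Omega>" using lact_closed d_closed by blast
  ultimately have "linear_span \<Omega> ?S = carrier \<Omega>"
    unfolding linear_span_def using M.carrier_is_submodule by blast
  moreover have "linear_map A \<Omega> d"
    unfolding linear_map_def using d_closed d_add d_smult by blast
  ultimately show ?thesis
    unfolding first_order_differential_calculus_def
    using complex_bimodule_axioms leibniz by blast
qed

section \<open>Linear maps on the free algebra\<close>

abbreviation word :: "nat list \<Rightarrow> ncpoly" where "word w \<equiv> Poly_Mapping.single w 1"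

lemma single_eq_const_word: "Poly_Mapping.single w c = nc_const c * word w"
  by (simp add: nc_const_def mult_single plus_list_def)

lemma word_append: "word (u @ v) = word u * word v"
  by (simp add: mult_single plus_list_def)

lemma word_Cons: "word (i # w) = nc_var i * word w"
  by (simp add: nc_var_def mult_single plus_list_def)

lemma word_Nil: "word [] = 1"
  by (simp flip: zero_list_def)

lemma nc_const_left_commute: "p * (nc_const c * r) = nc_const c * (p * r)"
  unfolding mult.assoc[symmetric] nc_const_comm[of c p] ..

lemma nc_const_mult_nc_const_mult:
  "(nc_const a * p) * (nc_const b * r) = nc_const (a * b) * (p * r)"
  unfolding nc_const_mult mult.assoc nc_const_left_commute[of p] ..

lemma nc_const_mult_single: "nc_const a * Poly_Mapping.single w c = Poly_Mapping.single w (a * c)"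
  by (simp add: nc_const_def mult_single plus_list_def)

lemma ncpoly_induct [consumes 1, case_names single add]:
  fixes p :: ncpoly
  assumes p: "Poly_Mapping.keys p \<subseteq> lists S"
    and single: "\<And>w c. w \<in> lists S \<Longrightarrow> P (Poly_Mapping.single w c)"
    and add: "\<And>p r. Poly_Mapping.keys p \<subseteq> lists S \<Longrightarrow> Poly_Mapping.keys r \<subseteq> lists S
      \<Longrightarrow> P p \<Longrightarrow> P r \<Longrightarrow> P (p + r)"
  shows "P p"
proof -
  let ?sum = "\<lambda>W. \<Sum>w\<in>W. Poly_Mapping.single w (Poly_Mapping.lookup p w)"
  have "Poly_Mapping.keys (?sum W) \<subseteq> lists S \<and> P (?sum W)" if "finite W" "W \<subseteq> lists S" for W
    using that
  proof induction
    case empty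
    then show ?case using single[of "[]" 0] by simp
  next
    case (insert w W)
    have "Poly_Mapping.keys (Poly_Mapping.single w (Poly_Mapping.lookup p w)) \<subseteq> lists S"
      using insert.prems by simp
    with insert show ?case
      using Poly_Mapping.keys_add[of "Poly_Mapping.single w (Poly_Mapping.lookup p w)" "?sum W"]
      by (auto intro!: add single)
  qed
  moreover have "p = ?sum (Poly_Mapping.keys p)"
    by (rule poly_mapping_eqI)
      (auto simp: lookup_sum lookup_single when_def in_keys_iff sum.delta' if_distrib cong: if_cong)
  ultimately show ?thesis using p by (metis finite_keys)
qed

lemma free_algebra_mult_closed:
  "p \<in> carrier (free_algebra n) \<Longrightarrow> r \<in> carrier (free_algebra n) \<Longrightarrow> p * r \<in> carrier (free_algebra n)"
  unfolding carrier_free_algebra by (rule keys_mult_lists)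

lemma free_algebra_add_closed:
  "p \<in> carrier (free_algebra n) \<Longrightarrow> r \<in> carrier (free_algebra n) \<Longrightarrow> p + r \<in> carrier (free_algebra n)"
  unfolding carrier_free_algebra by (intro order_trans[OF Poly_Mapping.keys_add] Un_least)

text \<open>
  Words form a basis of the free algebra, so a linear map out of it may be prescribed on words.
\<close>

definition linear_extension :: "(nat list \<Rightarrow> ncpoly) \<Rightarrow> ncpoly \<Rightarrow> ncpoly"
  where "linear_extension g p =
    (\<Sum>w\<in>Poly_Mapping.keys p. nc_const (Poly_Mapping.lookup p w) * g w)"

lemma linear_extension_superset:
  assumes "finite W" "Poly_Mapping.keys p \<subseteq> W"
  shows "linear_extension g p = (\<Sum>w\<in>W. nc_const (Poly_Mapping.lookup p w) * g w)"
  unfolding linear_extension_def using assms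
  by (intro sum.mono_neutral_left) (auto simp: in_keys_iff nc_const_def)

lemma linear_extension_single: 
  "linear_extension g (Poly_Mapping.single w c) = nc_const c * g w"
  by (subst linear_extension_superset[of "{w}"]) auto

lemma linear_extension_add:
  "linear_extension g (p + r) = linear_extension g p + linear_extension g r"
proof -
  let ?W = "Poly_Mapping.keys p \<union> Poly_Mapping.keys r"
  have "Poly_Mapping.keys (p + r) \<subseteq> ?W" by (rule Poly_Mapping.keys_add)
  then show ?thesis
    by (simp add: linear_extension_superset[of ?W] lookup_add nc_const_add distrib_right
        sum.distrib)
qed

lemma linear_extension_const_mult:
  "linear_extension g (nc_const c * p) = nc_const c * linear_extension g p"
proof -
  have "Poly_Mapping.keys p \<subseteq> lists UNIV" by simp
  then show ?thesis
    by (induction p rule: ncpoly_induct)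
      (simp_all add: distrib_left linear_extension_add linear_extension_single
        nc_const_mult_single nc_const_mult mult.assoc)
qed

lemma linear_extension_diff:
  "linear_extension g (p - r) = linear_extension g p - linear_extension g r"
  using linear_extension_add[of g "p - r" r] by simp

lemma linear_extension_carrier:
  assumes p: "p \<in> carrier (free_algebra n)"
    and g: "\<And>w. w \<in> lists {1..n} \<Longrightarrow> g w \<in> carrier (free_algebra n)"
  shows "linear_extension g p \<in> carrier (free_algebra n)"
  using p unfolding carrier_free_algebra
proof (induction p rule: ncpoly_induct)
  case (single w c)
  then show ?case using g[of w] nc_const_carrier[of c n]
    by (simp add: linear_extension_single carrier_free_algebra keys_mult_lists)
next
  case (add p r)
  then show ?case
    unfolding linear_extension_add by (intro order_trans[OF Poly_Mapping.keys_add] Un_least)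
qed

lemma word_carrier: "w \<in> lists {1..n} \<Longrightarrow> word w \<in> carrier (free_algebra n)"
  by (simp add: carrier_free_algebra)

lemma free_algebra_induct [consumes 1, case_names const var add mult]:
  assumes p: "p \<in> carrier (free_algebra n)"
    and const: "\<And>c. P (nc_const c)"
    and var: "\<And>i. i \<in> {1..n} \<Longrightarrow> P (nc_var i)"
    and add: "\<And>p r. p \<in> carrier (free_algebra n) \<Longrightarrow> r \<in> carrier (free_algebra n)
      \<Longrightarrow> P p \<Longrightarrow> P r \<Longrightarrow> P (p + r)"
    and mult: "\<And>p r. p \<in> carrier (free_algebra n) \<Longrightarrow> r \<in> carrier (free_algebra n)
      \<Longrightarrow> P p \<Longrightarrow> P r \<Longrightarrow> P (p * r)"
  shows "P p"
proof -
  have word: "P (word w)" if "w \<in> lists {1..n}" for w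
    using that
  proof (induction w)
    case Nil
    then show ?case using const[of 1] by (simp add: nc_const_1 word_Nil)
  next
    case (Cons i w)
    then show ?case
      unfolding word_Cons by (intro mult var nc_var_carrier word_carrier) simp_all
  qed
  from p have "Poly_Mapping.keys p \<subseteq> lists {1..n}" by (simp only: carrier_free_algebra)
  then show ?thesis
  proof (induction p rule: ncpoly_induct)
    case (single w c)
    show ?case
      unfolding single_eq_const_word[of w c]
      by (intro mult const word nc_const_carrier word_carrier single)
  next
    case (add p r)
    then show ?case by (intro assms(4)) (simp_all only: carrier_free_algebra)
  qed
qed

section \<open>Skew partial derivatives of noncommutative polynomials\<close>

text \<open>
  The scalar by which the endomorphism \<open>\<sigma>\<^sub>i\<close> multiplies the word \<open>w\<close>: since
  \<open>\<eta>(\<epsilon>\<^sub>j, \<epsilon>\<^sub>i) = q\<^bsup>i - j\<^esup>\<close>, a letter \<open>j\<close> contributes the exponent \<open>i - j\<close>.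
\<close>

definition twist :: "complex \<Rightarrow> nat \<Rightarrow> nat list \<Rightarrow> complex"
  where "twist q i w = (\<Prod>j\<leftarrow>w. q powi (int i - int j))"

lemma twist_simps [simp]:
  "twist q i [] = 1"
  "twist q i (j # w) = q powi (int i - int j) * twist q i w"
  "twist q i (u @ v) = twist q i u * twist q i v"
  by (simp_all add: twist_def)

primrec word_partial :: "complex \<Rightarrow> nat \<Rightarrow> nat list \<Rightarrow> ncpoly"
  where "word_partial q i [] = 0"
  | "word_partial q i (j # w) = (if j = i then word w else 0)
      + nc_const (q powi (int i - int j)) * (nc_var j * word_partial q i w)"

text \<open>
  The twisted Leibniz rule on words, from which it follows on all polynomials by bilinearity.
\<close>

lemma word_partial_append:
  "word_partial q i (u @ v) =
    word_partial q i u * word v + nc_const (twist q i u) * (word u * word_partial q i v)"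
proof (induction u)
  case (Cons j u)
  let ?c = "nc_const (q powi (int i - int j))" and ?t = "nc_const (twist q i u)"
  have "word_partial q i ((j # u) @ v) = (if j = i then word u else 0) * word v
      + ?c * (nc_var j * (word_partial q i u * word v + ?t * (word u * word_partial q i v)))"
    by (simp add: Cons word_append)
  also have "\<dots> = word_partial q i (j # u) * word v
      + ?c * (nc_var j * (?t * (word u * word_partial q i v)))"
    by (simp add: distrib_left distrib_right mult.assoc add.assoc)
  also have "?c * (nc_var j * (?t * (word u * word_partial q i v))) =
      nc_const (twist q i (j # u)) * (word (j # u) * word_partial q i v)"
    unfolding nc_const_left_commute[of "nc_var j"] word_Cons
    by (simp add: nc_const_mult mult.assoc)
  finally show ?case .
qed (simp add: nc_const_1 word_Nil)

definition rescale :: "complex \<Rightarrow> nat \<Rightarrow> ncpoly \<Rightarrow> ncpoly"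
  where "rescale q i = linear_extension (\<lambda>w. nc_const (twist q i w) * word w)"

definition skew_partial :: "complex \<Rightarrow> nat \<Rightarrow> ncpoly \<Rightarrow> ncpoly"
  where "skew_partial q i = linear_extension (word_partial q i)"

lemma rescale_mult: "rescale q i (p * r) = rescale q i p * rescale q i r"
proof -
  have *: "Poly_Mapping.keys p \<subseteq> lists UNIV" for p :: ncpoly by simp
  from *[of p] show ?thesis
  proof (induction p rule: ncpoly_induct)
    case (single u a)
    from *[of r] show ?case
    proof (induction r rule: ncpoly_induct)
      case (single v b)
      have "rescale q i (Poly_Mapping.single w c) = Poly_Mapping.single w (c * twist q i w)" for w c
        by (simp add: rescale_def linear_extension_single nc_const_mult_single)
      then show ?case by (simp add: mult_single plus_list_def mult_ac)
    qed (simp add: rescale_def linear_extension_add distrib_left)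
  qed (simp add: rescale_def linear_extension_add distrib_right)
qed

lemma skew_partial_mult:
  "skew_partial q i (p * r) = skew_partial q i p * r + rescale q i p * skew_partial q i r"
proof -
  have *: "Poly_Mapping.keys p \<subseteq> lists UNIV" for p :: ncpoly by simp
  from *[of p] show ?thesis
  proof (induction p rule: ncpoly_induct)
    case (single u a)
    from *[of r] show ?case
    proof (induction r rule: ncpoly_induct)
      case (single v b)
      have "Poly_Mapping.single u a * Poly_Mapping.single v b = Poly_Mapping.single (u @ v) (a * b)"
        by (simp add: mult_single plus_list_def)
      then have "skew_partial q i (Poly_Mapping.single u a * Poly_Mapping.single v b) =
          nc_const (a * b) * (word_partial q i u * word v)
          + nc_const (a * b) * (nc_const (twist q i u) * (word u * word_partial q i v))"
        by (simp add: skew_partial_def linear_extension_single word_partial_append distrib_left)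
      also have "nc_const (a * b) * (word_partial q i u * word v) =
          skew_partial q i (Poly_Mapping.single u a) * Poly_Mapping.single v b"
        by (simp add: skew_partial_def linear_extension_single single_eq_const_word[of v b]
          nc_const_mult_nc_const_mult)
      also have "nc_const (a * b) * (nc_const (twist q i u) * (word u * word_partial q i v)) =
          rescale q i (Poly_Mapping.single u a) * skew_partial q i (Poly_Mapping.single v b)"
        unfolding skew_partial_def rescale_def linear_extension_single nc_const_mult_nc_const_mult
        by (simp only: mult.assoc)
      finally show ?case .
    qed (simp add: skew_partial_def linear_extension_add algebra_simps)
  qed (simp add: skew_partial_def rescale_def linear_extension_add distrib_right)
qed

lemma word_partial_carrier:
  "w \<in> lists {1..n} \<Longrightarrow> word_partial q i w \<in> carrier (free_algebra n)"
proof (induction w)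
  case Nil
  then show ?case by (simp add: carrier_free_algebra)
next
  case (Cons j w)
  have "nc_const c * (nc_var j * word_partial q i w) \<in> carrier (free_algebra n)" for c
    using Cons by (simp add: free_algebra_mult_closed nc_const_carrier nc_var_carrier)
  moreover have "(if j = i then word w else 0) \<in> carrier (free_algebra n)"
    using Cons.prems by (simp add: carrier_free_algebra)
  ultimately show ?case by (simp add: free_algebra_add_closed)
qed

lemma skew_partial_carrier:
  "p \<in> carrier (free_algebra n) \<Longrightarrow> skew_partial q i p \<in> carrier (free_algebra n)"
  unfolding skew_partial_def by (intro linear_extension_carrier word_partial_carrier)

lemma rescale_carrier:
  "p \<in> carrier (free_algebra n) \<Longrightarrow> rescale q i p \<in> carrier (free_algebra n)"
  unfolding rescale_def
  by (intro linear_extension_carrier)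
    (simp_all add: carrier_free_algebra flip: single_eq_const_word)

section \<open>The commutation factors on unit vectors\<close>

lemma star_unit_vec_right:
  assumes "k \<in> {1..n}"
  shows "star n \<alpha> (unit_vec k) = (\<Sum>i=1..n. if k < i then (int k - int i) * \<alpha> i else 0)"
proof -
  have "star n \<alpha> (unit_vec k) =
      (\<Sum>j=1..n-1. if j = k then (\<Sum>i=j+1..n. (int j - int i) * \<alpha> i) else 0)"
    unfolding star_def unit_vec_def by (intro sum.cong refl) auto
  also have "\<dots> = (if k \<in> {1..n-1} then (\<Sum>i=k+1..n. (int k - int i) * \<alpha> i) else 0)"
    by (subst sum.delta) simp_all
  also have "\<dots> = (\<Sum>i=k+1..n. (int k - int i) * \<alpha> i)"
    using assms by (auto intro!: sum.neutral[symmetric])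
  also have "\<dots> = (\<Sum>i=1..n. if k < i then (int k - int i) * \<alpha> i else 0)"
    by (rule sum.mono_neutral_cong_left) auto
  finally show ?thesis .
qed

lemma star_unit_vec_left:
  assumes "k \<in> {1..n}"
  shows "star n (unit_vec k) \<alpha> = (\<Sum>j=1..n. if j < k then (int j - int k) * \<alpha> j else 0)"
proof -
  have "star n (unit_vec k) \<alpha> =
      (\<Sum>j=1..n-1. \<Sum>i=j+1..n. if i = k then (int j - int i) * \<alpha> j else 0)"
    unfolding star_def unit_vec_def by (intro sum.cong refl) auto
  also have "\<dots> = (\<Sum>j=1..n-1. if j < k then (int j - int k) * \<alpha> j else 0)"
    using assms by (intro sum.cong refl) (subst sum.delta, auto)
  also have "\<dots> = (\<Sum>j=1..n. if j < k then (int j - int k) * \<alpha> j else 0)"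
    using assms by (intro sum.mono_neutral_left) auto
  finally show ?thesis .
qed

text \<open>
  The two parts of \<open>\<alpha> \<star> \<epsilon>\<^sub>k - \<epsilon>\<^sub>k \<star> \<alpha>\<close> run over \<open>j > k\<close> and \<open>j < k\<close>; with the
  signs taken into account they fit into one sum, in which the index \<open>k\<close> itself has coefficient 0.
\<close>

lemma eta_unit_vec:
  assumes "k \<in> {1..n}"
  shows "eta n q \<alpha> (unit_vec k) = q powi (\<Sum>j=1..n. (int k - int j) * \<alpha> j)"
  unfolding eta_def star_unit_vec_left[OF assms] star_unit_vec_right[OF assms] sum_subtractf[symmetric]
  by (rule arg_cong[of _ _ "power_int q"], rule sum.cong) (auto simp: algebra_simps)

lemma eta_unit_vec_unit_vec:
  assumes "i \<in> {1..n}" "j \<in> {1..n}"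
  shows "eta n q (unit_vec i) (unit_vec j) = q powi (int j - int i)"
proof -
  have "(\<Sum>k=1..n. (int j - int k) * unit_vec i k) = int j - int i"
    using assms(1) by (simp add: unit_vec_def if_distrib cong: if_cong)
  then show ?thesis by (simp only: eta_unit_vec[OF assms(2)])
qed

section \<open>Compatibility with the relations of quantum space\<close>

lemma a_inv_free_algebra:
  "p \<in> carrier (free_algebra n) \<Longrightarrow> a_inv (free_algebra n) p = - p"
proof -
  interpret F: ring "free_algebra n" by (rule ring_free_algebra)
  assume p: "p \<in> carrier (free_algebra n)"
  then show ?thesis
    by (intro F.minus_equality) (auto simp: free_algebra_def)
qed

lemma quantum_ideal_carrier: "p \<in> quantum_ideal n q \<Longrightarrow> p \<in> carrier (free_algebra n)"
  by (rule additive_subgroup.a_Hcarr[OF ideal.axioms(1)[OF ideal_quantum_ideal]])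

lemma zero_in_quantum_ideal: "0 \<in> quantum_ideal n q"
  using additive_subgroup.zero_closed[OF ideal.axioms(1)[OF ideal_quantum_ideal]]
  by (simp add: free_algebra_def)

lemma add_in_quantum_ideal:
  "p \<in> quantum_ideal n q \<Longrightarrow> r \<in> quantum_ideal n q \<Longrightarrow> p + r \<in> quantum_ideal n q"
  using additive_subgroup.a_closed[OF ideal.axioms(1)[OF ideal_quantum_ideal], of p n q r]
  by (simp add: free_algebra_def)

lemma mult_in_quantum_ideal_left:
  "p \<in> quantum_ideal n q \<Longrightarrow> r \<in> carrier (free_algebra n) \<Longrightarrow> r * p \<in> quantum_ideal n q"
  using ideal.I_l_closed[OF ideal_quantum_ideal, of p n q r] by (simp add: free_algebra_def)

lemma mult_in_quantum_ideal_right: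
  "p \<in> quantum_ideal n q \<Longrightarrow> r \<in> carrier (free_algebra n) \<Longrightarrow> p * r \<in> quantum_ideal n q"
  using ideal.I_r_closed[OF ideal_quantum_ideal, of p n q r] by (simp add: free_algebra_def)

lemma quantum_relator_in_ideal:
  assumes "i \<in> {1..n}" "j \<in> {1..n}"
  shows "nc_var i * nc_var j - nc_const (q powi (int j - int i)) * (nc_var j * nc_var i)
    \<in> quantum_ideal n q"
proof -
  have "nc_var i * nc_var j - nc_const (eta n q (unit_vec i) (unit_vec j)) * (nc_var j * nc_var i)
      \<in> quantum_relators n q"
    using assms by (auto simp: quantum_relators_def)
  then show ?thesis
    using ring.genideal_self[OF ring_free_algebra relators_carrier]
    unfolding quantum_ideal_def eta_unit_vec_unit_vec[OF assms] by blast
qed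

lemma skew_partial_nc_var: "skew_partial q i (nc_var j) = (if j = i then 1 else 0)"
  by (simp add: skew_partial_def nc_var_def linear_extension_single nc_const_1 word_Nil)

lemma rescale_nc_var: "rescale q i (nc_var j) = nc_const (q powi (int i - int j)) * nc_var j"
  by (simp add: rescale_def nc_var_def linear_extension_single nc_const_1)

text \<open>
  If \<open>k = i\<close>, the two products contribute \<open>q\<^bsup>k - j\<^esup> x\<^sub>j\<close> with opposite signs; if \<open>j = i\<close>,
  they contribute \<open>x\<^sub>k\<close> and \<open>q\<^bsup>k - j\<^esup> q\<^bsup>j - k\<^esup> x\<^sub>k\<close>, which cancel as \<open>q\<close> is invertible.
\<close>

lemma skew_partial_relator:
  assumes "q \<noteq> 0"
  shows "skew_partial q i
    (nc_var j * nc_var k - nc_const (q powi (int k - int j)) * (nc_var k * nc_var j)) = 0"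
proof -
  have inv: "nc_const (q powi (int k - int j)) * (nc_const (q powi (int j - int k)) * p) = p" for j k p
    using assms by (simp add: nc_const_1 flip: mult.assoc nc_const_mult power_int_add)
  show ?thesis
    by (simp add: skew_partial_def linear_extension_diff linear_extension_const_mult)
     (simp add: inv nc_const_1 skew_partial_mult skew_partial_nc_var rescale_nc_var distrib_left 
       flip: skew_partial_def)
qed

text \<open>
  Both monomials of a relator contain the same letters and hence are scaled by the same factor.
\<close>

lemma rescale_relator:
  "rescale q i
    (nc_var j * nc_var k - nc_const c * (nc_var k * nc_var j)) =
   nc_const (q powi (int i - int j) * q powi (int i - int k)) *
     (nc_var j * nc_var k - nc_const c * (nc_var k * nc_var j))"
proof -
  let ?a = "q powi (int i - int j)" and ?b = "q powi (int i - int k)"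
  have "rescale q i (nc_var j * nc_var k - nc_const c * (nc_var k * nc_var j)) =
    rescale q i (nc_var j) * rescale q i (nc_var k)
      - nc_const c * (rescale q i (nc_var k) * rescale q i (nc_var j))"
    unfolding rescale_mult[symmetric]
    by (simp add: rescale_def linear_extension_diff linear_extension_const_mult)
  also have "\<dots> = nc_const (?a * ?b) * (nc_var j * nc_var k)
      - nc_const c * (nc_const (?a * ?b) * (nc_var k * nc_var j))"
    unfolding rescale_nc_var nc_const_mult_nc_const_mult by (simp add: mult.commute)
  also have "\<dots> = nc_const (?a * ?b) * (nc_var j * nc_var k - nc_const c * (nc_var k * nc_var j))"
    by (simp add: right_diff_distrib nc_const_left_commute[of "nc_const c"])
  finally show ?thesis .
qed

text \<open>
  Elements of the ideal whose images under both maps stay in the ideal again form an ideal, and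
  it contains the relators. The two maps have to be treated together: by the twisted Leibniz rule
  the derivative of \<open>p r\<close> involves \<open>\<sigma>\<^sub>i(p)\<close>.
\<close>

lemma skew_partial_rescale_quantum_ideal:
  assumes q: "q \<noteq> 0" and p: "p \<in> quantum_ideal n q"
  shows "skew_partial q i p \<in> quantum_ideal n q" "rescale q i p \<in> quantum_ideal n q"
proof -
  let ?F = "free_algebra n" and ?I = "quantum_ideal n q"
  let ?J = "{p \<in> ?I. rescale q i p \<in> ?I \<and> skew_partial q i p \<in> ?I}"
  note closed = add_in_quantum_ideal mult_in_quantum_ideal_left mult_in_quantum_ideal_right
  have "ideal ?J ?F"
  proof (rule idealI[OF ring_free_algebra])
    show "subgroup ?J (add_monoid ?F)"
    proof (rule group.subgroupI)
      show "group (add_monoid ?F)"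
        using ring_free_algebra by (simp add: ring_def abelian_group.a_group)
      show "?J \<noteq> {}"
        using zero_in_quantum_ideal
        by (auto intro!: exI[of _ 0] simp: rescale_def skew_partial_def linear_extension_def)
    next
      fix p assume p: "p \<in> ?J"
      have "- r = nc_const (- 1) * r" for r :: ncpoly
        by (simp add: nc_const_def single_uminus flip: zero_list_def)
      with p have "- p \<in> ?J"
        using mult_in_quantum_ideal_left[OF _ nc_const_carrier[of "-1"]]
        by (simp add: rescale_def skew_partial_def linear_extension_const_mult)
      then show "inv\<^bsub>add_monoid ?F\<^esub> p \<in> ?J"
        using a_inv_free_algebra[of p n] p quantum_ideal_carrier by (auto simp: a_inv_def)
    next
      fix p r assume "p \<in> ?J" "r \<in> ?J"
      then show "p \<otimes>\<^bsub>add_monoid ?F\<^esub> r \<in> ?J"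
        by (simp add: free_algebra_def rescale_def skew_partial_def linear_extension_add closed)
    qed (use quantum_ideal_carrier in auto)
  next
    fix p r assume "p \<in> ?J" "r \<in> carrier ?F"
    then have "r * p \<in> ?J" "p * r \<in> ?J"
      by (simp_all add: closed skew_partial_mult rescale_mult skew_partial_carrier rescale_carrier)
    then show "r \<otimes>\<^bsub>?F\<^esub> p \<in> ?J" "p \<otimes>\<^bsub>?F\<^esub> r \<in> ?J"
      by (simp_all add: free_algebra_def)
  qed
  moreover have "quantum_relators n q \<subseteq> ?J"
  proof
    fix p assume "p \<in> quantum_relators n q"
    then obtain j k where jk: "j \<in> {1..n}" "k \<in> {1..n}"
      and "p = nc_var j * nc_var k
        - nc_const (eta n q (unit_vec j) (unit_vec k)) * (nc_var k * nc_var j)"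
      unfolding quantum_relators_def by blast
    then have p: "p = nc_var j * nc_var k
        - nc_const (q powi (int k - int j)) * (nc_var k * nc_var j)"
      by (simp only: eta_unit_vec_unit_vec)
    have I: "p \<in> ?I" unfolding p by (rule quantum_relator_in_ideal[OF jk])
    then have "rescale q i p \<in> ?I"
      unfolding p rescale_relator by (intro mult_in_quantum_ideal_left nc_const_carrier)
    moreover have "skew_partial q i p = 0" unfolding p by (rule skew_partial_relator[OF q])
    ultimately show "p \<in> ?J" using I by (simp add: zero_in_quantum_ideal)
  qed
  ultimately have "?I \<subseteq> ?J"
    unfolding quantum_ideal_def[of n q] by (intro ring.genideal_minimal[OF ring_free_algebra])
  then show "skew_partial q i p \<in> ?I" "rescale q i p \<in> ?I" using p by auto
qed

section \<open>The projection onto quantum space\<close>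

definition quantum_proj :: "nat \<Rightarrow> complex \<Rightarrow> ncpoly \<Rightarrow> ncpoly set"
  where "quantum_proj n q p = quantum_ideal n q +>\<^bsub>free_algebra n\<^esub> p"

lemma quantum_gen_eq_proj: "quantum_gen n q i = quantum_proj n q (nc_var i)"
  by (simp add: quantum_gen_def quantum_proj_def)

lemma quantum_proj_ring_hom: "quantum_proj n q \<in> ring_hom (free_algebra n) (quantum_space n q)"
  using ideal.rcos_ring_hom[OF ideal_quantum_ideal, of n q]
  unfolding quantum_space_def quotient_algebra_def ring_hom_def quantum_proj_def by simp

lemma quantum_proj_closed:
  "p \<in> carrier (free_algebra n) \<Longrightarrow> quantum_proj n q p \<in> carrier (quantum_space n q)"
  by (rule ring_hom_closed[OF quantum_proj_ring_hom])

lemma quantum_proj_add: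
  "p \<in> carrier (free_algebra n) \<Longrightarrow> r \<in> carrier (free_algebra n) \<Longrightarrow>
    quantum_proj n q (p + r) = quantum_proj n q p \<oplus>\<^bsub>quantum_space n q\<^esub> quantum_proj n q r"
  using ring_hom_add[OF quantum_proj_ring_hom, of p n r q] by (simp add: free_algebra_def)

lemma quantum_proj_mult:
  "p \<in> carrier (free_algebra n) \<Longrightarrow> r \<in> carrier (free_algebra n) \<Longrightarrow>
    quantum_proj n q (p * r) = quantum_proj n q p \<otimes>\<^bsub>quantum_space n q\<^esub> quantum_proj n q r"
  using ring_hom_mult[OF quantum_proj_ring_hom, of p n r q] by (simp add: free_algebra_def)

lemma quantum_proj_one: "quantum_proj n q 1 = \<one>\<^bsub>quantum_space n q\<^esub>"
  using ring_hom_one[OF quantum_proj_ring_hom, of n q] by (simp add: free_algebra_def)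

lemma quantum_proj_const_mult:
  assumes "p \<in> carrier (free_algebra n)"
  shows "quantum_proj n q (nc_const c * p) = c \<odot>\<^bsub>quantum_space n q\<^esub> quantum_proj n q p"
proof -
  have "c \<odot>\<^bsub>quantum_space n q\<^esub> Y = quantum_proj n q (nc_const c) \<otimes>\<^bsub>quantum_space n q\<^esub> Y" for Y
    by (simp add: quantum_space_def quotient_algebra_def quantum_proj_def) (simp add: free_algebra_def)
  then show ?thesis using quantum_proj_mult[OF nc_const_carrier assms] by simp
qed

lemma quantum_proj_surj:
  assumes "Y \<in> carrier (quantum_space n q)"
  obtains p where "p \<in> carrier (free_algebra n)" "Y = quantum_proj n q p"
  using assms unfolding quantum_space_def quotient_algebra_def FactRing_def A_RCOSETS_def' quantum_proj_def
  by auto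

lemma quantum_proj_eq_iff:
  assumes "p \<in> carrier (free_algebra n)" "r \<in> carrier (free_algebra n)"
  shows "quantum_proj n q p = quantum_proj n q r \<longleftrightarrow> p - r \<in> quantum_ideal n q"
proof -
  have "p \<ominus>\<^bsub>free_algebra n\<^esub> r = p - r"
    using assms by (simp add: a_minus_def a_inv_free_algebra) (simp add: free_algebra_def)
  then show ?thesis
    using ring.quotient_eq_iff_same_a_r_cos[OF ring_free_algebra ideal_quantum_ideal assms, of q]
    by (simp add: quantum_proj_def)
qed

section \<open>Ordered monomials span quantum space\<close>

lemma quantum_proj_swap:
  assumes "i \<in> {1..n}" "j \<in> {1..n}" and w: "w \<in> lists {1..n}"
  shows "quantum_proj n q (word (i # j # w)) =
    quantum_proj n q (nc_const (q powi (int j - int i)) * word (j # i # w))"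
proof -
  let ?c = "nc_const (q powi (int j - int i))"
  have "word (i # j # w) - ?c * word (j # i # w) =
      (nc_var i * nc_var j - ?c * (nc_var j * nc_var i)) * word w"
    unfolding word_Cons by (simp add: left_diff_distrib mult.assoc)
  also have "\<dots> \<in> quantum_ideal n q"
    by (intro mult_in_quantum_ideal_right quantum_relator_in_ideal word_carrier assms)
  finally show ?thesis
    using assms by (subst quantum_proj_eq_iff)
      (simp_all add: word_carrier free_algebra_mult_closed nc_const_carrier)
qed

lemma quantum_proj_cong_mult_left:
  assumes "quantum_proj n q p = quantum_proj n q r" and
    "p \<in> carrier (free_algebra n)" "r \<in> carrier (free_algebra n)" "s \<in> carrier (free_algebra n)"
  shows "quantum_proj n q (s * p) = quantum_proj n q (s * r)"
  using assms by (simp add: quantum_proj_mult)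

text \<open>
  Moving the first letter to the right past smaller letters costs one scalar per transposition.
\<close>

lemma quantum_proj_insort:
  assumes i: "i \<in> {1..n}" and w: "w \<in> lists {1..n}"
  shows "\<exists>c. quantum_proj n q (word (i # w)) = quantum_proj n q (nc_const c * word (insort i w))"
  using w
proof (induction w)
  case Nil
  show ?case by (intro exI[of _ 1]) (simp add: nc_const_1)
next
  case (Cons j w)
  then have j: "j \<in> {1..n}" and w: "w \<in> lists {1..n}" by auto
  show ?case
  proof (cases "i \<le> j")
    case True
    then show ?thesis by (intro exI[of _ 1]) (simp add: nc_const_1)
  next
    case False
    obtain c where c: "quantum_proj n q (word (i # w)) = quantum_proj n q (nc_const c * word (insort i w))"
      using Cons.IH w by blast
    let ?b = "q powi (int j - int i)"
    have carr: "word (i # w) \<in> carrier (free_algebra n)" 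
       "word (insort i w) \<in> carrier (free_algebra n)"
      using i w by (auto intro!: word_carrier simp: set_insort_key)
    have "quantum_proj n q (word (i # j # w)) = quantum_proj n q ((nc_const ?b * nc_var j) * word (i # w))"
      by (simp add: quantum_proj_swap[OF i j w] word_Cons[of j] mult.assoc)
    also have "\<dots> = quantum_proj n q ((nc_const ?b * nc_var j) * (nc_const c * word (insort i w)))"
      using c carr j by (intro quantum_proj_cong_mult_left)
        (simp_all add: free_algebra_mult_closed nc_const_carrier nc_var_carrier)
    also have "(nc_const ?b * nc_var j) * (nc_const c * word (insort i w)) =
        nc_const (?b * c) * word (insort i (j # w))"
      using False unfolding nc_const_mult_nc_const_mult by (simp add: word_Cons[of j])
    finally show ?thesis by blast
  qed
qed

lemma quantum_proj_sort:
  assumes "w \<in> lists {1..n}"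
  shows "\<exists>c. quantum_proj n q (word w) = quantum_proj n q (nc_const c * word (sort w))"
  using assms
proof (induction w)
  case Nil
  show ?case by (intro exI[of _ 1]) (simp add: nc_const_1)
next
  case (Cons i w)
  then have i: "i \<in> {1..n}" and w: "w \<in> lists {1..n}" by auto
  obtain c where c: "quantum_proj n q (word w) = quantum_proj n q (nc_const c * word (sort w))"
    using Cons.IH w by blast
  have sw: "sort w \<in> lists {1..n}" using w by (simp add: in_lists_conv_set)
  obtain b where b: "quantum_proj n q (word (i # sort w)) =
      quantum_proj n q (nc_const b * word (insort i (sort w)))"
    using quantum_proj_insort[OF i sw] by blast
  have carr: "word w \<in> carrier (free_algebra n)" "word (sort w) \<in> carrier (free_algebra n)"
     "word (i # sort w) \<in> carrier (free_algebra n)" 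
     "word (insort i (sort w)) \<in> carrier (free_algebra n)" 
     "nc_const c \<in> carrier (free_algebra n)" "nc_const b \<in> carrier (free_algebra n)"
     "nc_var i \<in> carrier (free_algebra n)"
    using i w sw by (auto intro!: word_carrier nc_const_carrier nc_var_carrier simp: set_insort_key)
  have "quantum_proj n q (word (i # w)) = quantum_proj n q (nc_var i * (nc_const c * word (sort w)))"
    unfolding word_Cons using carr
    by (intro quantum_proj_cong_mult_left[OF c]) (simp_all add: free_algebra_mult_closed)
  also have "nc_var i * (nc_const c * word (sort w)) = nc_const c * word (i # sort w)"
    unfolding word_Cons nc_const_left_commute[of "nc_var i"] ..
  also have "quantum_proj n q (nc_const c * word (i # sort w)) =
      quantum_proj n q (nc_const c * (nc_const b * word (insort i (sort w))))"
    using carr by (intro quantum_proj_cong_mult_left[OF b]) (simp_all add: free_algebra_mult_closed)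
  also have "nc_const c * (nc_const b * word (insort i (sort w))) = nc_const (c * b) * word (sort (i # w))"
    by (simp add: nc_const_mult mult.assoc)
  finally show ?case by blast
qed

text \<open>
  With \<open>js = [1, \<dots>, n]\<close> this is the word of the ordered monomial with exponents \<open>k\<close>.
\<close>

definition blocks :: "(nat \<Rightarrow> nat) \<Rightarrow> nat list \<Rightarrow> nat list"
  where "blocks k js = concat (map (\<lambda>j. replicate (k j) j) js)"

lemma blocks_simps [simp]:
  "blocks k [] = []"
  "blocks k (j # js) = replicate (k j) j @ blocks k js"
  "blocks k (is @ js) = blocks k is @ blocks k js"
  by (simp_all add: blocks_def)

lemma set_blocks: "set (blocks k js) \<subseteq> set js"
  by (induction js) auto

lemma blocks_in_lists: "set js \<subseteq> S \<Longrightarrow> blocks k js \<in> lists S"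
  using set_blocks[of k js] by (simp add: lists_eq_set)

lemma sorted_blocks: "sorted js \<Longrightarrow> sorted (blocks k js)"
proof (induction js)
  case (Cons j js)
  then show ?case using set_blocks[of k js] by (auto simp: sorted_append)
qed simp

lemma count_blocks:
  "distinct js \<Longrightarrow> count (mset (blocks k js)) j = (if j \<in> set js then k j else 0)"
  by (induction js) auto

lemma sort_eq_blocks:
  assumes "w \<in> lists {1..n}"
  shows "sort w = blocks (count (mset w)) [1..<Suc n]"
proof (rule properties_for_sort)
  show "mset (blocks (count (mset w)) [1..<Suc n]) = mset w"
  proof (rule multiset_eqI)
    fix j
    have "count (mset w) j = 0" if "j \<notin> set [1..<Suc n]"
      using that assms by (auto simp: count_eq_zero_iff)
    then show "count (mset (blocks (count (mset w)) [1..<Suc n])) j = count (mset w) j"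
      by (subst count_blocks) auto
  qed
qed (rule sorted_blocks[OF sorted_upt])

lemma quantum_gen_pow:
  assumes "i \<in> {1..n}"
  shows "quantum_gen n q i [^]\<^bsub>quantum_space n q\<^esub> k = quantum_proj n q (word (replicate k i))"
proof (induction k)
  case 0
  then show ?case by (simp add: word_Nil quantum_proj_one nat_pow_def)
next
  case (Suc k)
  have "quantum_gen n q i [^]\<^bsub>quantum_space n q\<^esub> Suc k =
      quantum_proj n q (word (replicate k i)) \<otimes>\<^bsub>quantum_space n q\<^esub> quantum_proj n q (nc_var i)"
    using Suc by (simp add: nat_pow_def quantum_gen_eq_proj)
  also have "\<dots> = quantum_proj n q (word (replicate k i) * nc_var i)"
    using assms by (subst quantum_proj_mult) (auto intro!: word_carrier nc_var_carrier)
  also have "word (replicate k i) * nc_var i = word (replicate (Suc k) i)"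
    unfolding nc_var_def word_append[symmetric] by (simp add: replicate_append_same)
  finally show ?case .
qed

lemma quantum_monomial_eq_blocks:
  assumes "\<forall>i\<in>{1..n}. 0 \<le> \<alpha> i"
  shows "quantum_monomial n q \<alpha> =
    quantum_proj n q (word (blocks (\<lambda>i. nat (\<alpha> i)) [1..<Suc n]))"
proof -
  have "foldr (\<lambda>i m. (quantum_gen n q i [^]\<^bsub>quantum_space n q\<^esub> nat (\<alpha> i)) \<otimes>\<^bsub>quantum_space n q\<^esub> m)
      js \<one>\<^bsub>quantum_space n q\<^esub> = quantum_proj n q (word (blocks (\<lambda>i. nat (\<alpha> i)) js))"
    if "set js \<subseteq> {1..n}" for js
    using that
  proof (induction js)
    case Nil
    then show ?case by (simp add: word_Nil quantum_proj_one)
  next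
    case (Cons j js)
    have "word (replicate (nat (\<alpha> j)) j) \<in> carrier (free_algebra n)"
      "word (blocks (\<lambda>i. nat (\<alpha> i)) js) \<in> carrier (free_algebra n)"
      using Cons.prems by (auto intro!: word_carrier blocks_in_lists)
    with Cons show ?case
      by (simp add: quantum_gen_pow word_append quantum_proj_mult)
  qed
  moreover have "set [1..<Suc n] \<subseteq> {1..n}" by auto
  ultimately show ?thesis unfolding quantum_monomial_def if_P[OF assms] by blast
qed

lemma quantum_monomial_closed:
  assumes "\<forall>i\<in>{1..n}. 0 \<le> \<alpha> i"
  shows "quantum_monomial n q \<alpha> \<in> carrier (quantum_space n q)"
  unfolding quantum_monomial_eq_blocks[OF assms]
  by (intro quantum_proj_closed word_carrier blocks_in_lists) auto

lemma quantum_proj_word_eq_monomial: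
  assumes "w \<in> lists {1..n}"
  obtains c where "quantum_proj n q (word w) =
    c \<odot>\<^bsub>quantum_space n q\<^esub> quantum_monomial n q (\<lambda>i. int (count (mset w) i))"
proof -
  obtain c where "quantum_proj n q (word w) = quantum_proj n q (nc_const c * word (sort w))"
    using quantum_proj_sort[OF assms] by blast
  also have "\<dots> = c \<odot>\<^bsub>quantum_space n q\<^esub> quantum_proj n q (word (sort w))"
    using assms by (intro quantum_proj_const_mult word_carrier) (simp add: in_lists_conv_set)
  also have "quantum_proj n q (word (sort w)) = quantum_monomial n q (\<lambda>i. int (count (mset w) i))"
    by (subst quantum_monomial_eq_blocks) (simp_all add: sort_eq_blocks[OF assms] del: upt_Suc)
  finally show ?thesis by (rule that)
qed

text \<open>
  Ordered monomials span, since sorting turns every word into a scalar multiple of one of them.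
\<close>

lemma linear_map_eq_on_monomials:
  assumes "linear_map (quantum_space n q) W D" "linear_map (quantum_space n q) W E"
    and eq: "\<And>\<alpha>. \<forall>j\<in>{1..n}. 0 \<le> \<alpha> j \<Longrightarrow>
      D (quantum_monomial n q \<alpha>) = E (quantum_monomial n q \<alpha>)"
    and Y: "Y \<in> carrier (quantum_space n q)"
  shows "D Y = E Y"
proof -
  let ?A = "quantum_space n q"
  note lin = linear_map_add[OF assms(1)] linear_map_smult[OF assms(1)]
    linear_map_add[OF assms(2)] linear_map_smult[OF assms(2)]
  obtain p where "p \<in> carrier (free_algebra n)" and p: "Y = quantum_proj n q p"
    using quantum_proj_surj[OF Y] .
  then have "Poly_Mapping.keys p \<subseteq> lists {1..n}" by (simp only: carrier_free_algebra)
  then have "D (quantum_proj n q p) = E (quantum_proj n q p)"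
  proof (induction p rule: ncpoly_induct)
    case (single w c)
    let ?m = "quantum_monomial n q (\<lambda>i. int (count (mset w) i))"
    have m: "?m \<in> carrier ?A"
      by (rule quantum_monomial_closed) simp
    obtain b where b: "quantum_proj n q (word w) = b \<odot>\<^bsub>?A\<^esub> ?m"
      using quantum_proj_word_eq_monomial[OF single] .
    have "quantum_proj n q (Poly_Mapping.single w c) = c \<odot>\<^bsub>?A\<^esub> quantum_proj n q (word w)"
      unfolding single_eq_const_word[of w c] by (rule quantum_proj_const_mult[OF word_carrier[OF single]])
    moreover have "quantum_proj n q (word w) \<in> carrier ?A"
      by (intro quantum_proj_closed word_carrier single)
    moreover have "D ?m = E ?m" by (rule eq) simp
    ultimately show ?case by (simp add: b lin m)
  next
    case (add p r)
    then show ?case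
      by (simp add: carrier_free_algebra quantum_proj_add quantum_proj_closed lin)
  qed
  then show ?thesis by (simp add: p)
qed

section \<open>Partial derivatives on quantum space\<close>

lemma word_partial_absent: "i \<notin> set w \<Longrightarrow> word_partial q i w = 0"
  by (induction w) auto

lemma word_partial_replicate:
  "word_partial q i (replicate m i) = nc_const (of_nat m) * word (replicate (m - 1) i)"
proof (induction m)
  case 0
  then show ?case by (simp add: nc_const_def)
next
  case (Suc m)
  have "nc_var i * (nc_const (of_nat m) * word (replicate (m - 1) i)) =
      nc_const (of_nat m) * word (replicate m i)"
    by (cases m) (simp_all add: nc_const_def nc_const_left_commute[of "nc_var i", unfolded nc_const_def] 
       flip: word_Cons)
  with Suc show ?case by (simp add: nc_const_1 nc_const_add distrib_right)
qed

lemma twist_blocks: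
  assumes "q \<noteq> 0"
  shows "twist q i (blocks k js) = q powi (\<Sum>j\<leftarrow>js. (int i - int j) * int (k j))"
proof -
  have "twist q i (replicate m j) = q powi ((int i - int j) * int m)" for m j
    using assms by (induction m) (simp_all add: distrib_left power_int_add)
  then show ?thesis using assms by (induction js) (simp_all add: power_int_add)
qed

lemma eta_initial_segment:
  assumes "i \<in> {1..n}"
  shows "eta n q (\<lambda>j. if j < i then \<alpha> j else 0) (unit_vec i) =
    q powi (\<Sum>j=1..<i. (int i - int j) * \<alpha> j)"
proof -
  have "(\<Sum>j=1..n. (int i - int j) * (if j < i then \<alpha> j else 0)) =
      (\<Sum>j=1..<i. (int i - int j) * \<alpha> j)"
    using assms by (intro sum.mono_neutral_cong_right) auto
  then show ?thesis by (simp only: eta_unit_vec[OF assms])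
qed

text \<open>
  The letters before block \<open>i\<close> contribute their twist, which is the factor \<open>\<eta>\<close>. Within
  block \<open>i\<close> the twist is trivial, so each of its \<open>k i\<close> letters contributes the same word.
  If \<open>k i = 0\<close>, the truncated exponent is harmless because the coefficient vanishes.
\<close>

lemma word_partial_blocks:
  assumes q: "q \<noteq> 0" and i: "i \<in> {1..n}"
  shows "word_partial q i (blocks k [1..<Suc n]) =
    nc_const (eta n q (\<lambda>j. if j < i then int (k j) else 0) (unit_vec i) * of_nat (k i))
      * word (blocks (k(i := k i - 1)) [1..<Suc n])"
proof -
  let ?u = "blocks k [1..<i]" and ?v = "blocks k [Suc i..<Suc n]"
  have split: "[1..<Suc n] = [1..<i] @ i # [Suc i..<Suc n]"
    using i upt_add_eq_append[of 1 i "Suc n - i"] by (simp add: upt_conv_Cons del: upt_Suc)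
  have upd: "blocks (k(i := m)) js = blocks k js" if "i \<notin> set js" for js m
    using that by (induction js) auto
  have absent: "i \<notin> set ?u" "i \<notin> set ?v"
    using set_blocks[of k "[1..<i]"] set_blocks[of k "[Suc i..<Suc n]"] by auto
  have twist: "twist q i ?u = eta n q (\<lambda>j. if j < i then int (k j) else 0) (unit_vec i)"
    unfolding eta_initial_segment[OF i] twist_blocks[OF q]
    by (simp add: sum_list_distinct_conv_sum_set)
  have "word_partial q i (blocks k [1..<Suc n]) =
      nc_const (twist q i ?u) * (word ?u * (nc_const (of_nat (k i)) * word (replicate (k i - 1) i) * word ?v))"
    unfolding split using absent
    by (simp add: word_partial_append word_partial_absent word_partial_replicate del: upt_Suc)
  also have "\<dots> = nc_const (twist q i ?u * of_nat (k i)) *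
      word (?u @ replicate (k i - 1) i @ ?v)"
    unfolding word_append mult.assoc nc_const_left_commute[of "word ?u"] nc_const_mult ..
  also have "?u @ replicate (k i - 1) i @ ?v = blocks (k(i := k i - 1)) [1..<Suc n]"
    unfolding split by (simp add: upd del: upt_Suc)
  finally show ?thesis unfolding twist .
qed

lemma quantum_proj_skew_partial_cong:
  assumes "q \<noteq> 0" and p: "p \<in> carrier (free_algebra n)" and r: "r \<in> carrier (free_algebra n)"
    and "quantum_proj n q p = quantum_proj n q r"
  shows "quantum_proj n q (skew_partial q i p) = quantum_proj n q (skew_partial q i r)"
proof -
  have "skew_partial q i (p - r) \<in> quantum_ideal n q"
    using assms by (intro skew_partial_rescale_quantum_ideal) (simp_all add: quantum_proj_eq_iff)
  then show ?thesis using p r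
    by (simp add: quantum_proj_eq_iff skew_partial_carrier)
      (simp add: skew_partial_def linear_extension_diff)
qed

lemma quantum_proj_zero: "quantum_proj n q 0 = \<zero>\<^bsub>quantum_space n q\<^esub>"
proof -
  interpret complex_algebra "quantum_space n q" by (rule complex_algebra_quantum_space)
  have c: "0 \<in> carrier (free_algebra n)" by (simp add: carrier_free_algebra)
  have "quantum_proj n q 0 \<oplus>\<^bsub>quantum_space n q\<^esub> quantum_proj n q 0 = quantum_proj n q 0"
    using quantum_proj_add[OF c c, of q] by simp
  then show ?thesis using quantum_proj_closed[OF c, of q] by simp
qed

text \<open>
  The skew derivation of the free algebra descends to a linear map on quantum space with the
  values that define \<open>\<partial>\<^sub>i\<close>. Ordered monomials span, so it is the only such map and the
  definite description in \<^const>\<open>quantum_partial\<close> denotes it.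
\<close>

lemma quantum_partial_proj_and_linear:
  assumes q: "q \<noteq> 0" and i: "i \<in> {1..n}"
  shows "p \<in> carrier (free_algebra n) \<Longrightarrow>
      quantum_partial n q i (quantum_proj n q p) = quantum_proj n q (skew_partial q i p)"
    and "linear_map (quantum_space n q) (quantum_space n q) (quantum_partial n q i)"
proof -
  let ?F = "free_algebra n" and ?A = "quantum_space n q"
  \<comment> \<open>The descended map, computed on a chosen representative of each class.\<close>
  define D where "D = (\<lambda>Y\<in>carrier ?A. quantum_proj n q
    (skew_partial q i (SOME p. p \<in> carrier ?F \<and> quantum_proj n q p = Y)))"
  have D_proj: "D (quantum_proj n q p) = quantum_proj n q (skew_partial q i p)"
    if p: "p \<in> carrier ?F" for p
  proof -
    let ?r = "SOME r. r \<in> carrier ?F \<and> quantum_proj n q r = quantum_proj n q p"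
    have "?r \<in> carrier ?F \<and> quantum_proj n q ?r = quantum_proj n q p"
      by (rule someI_ex) (use p in blast)
    then have "quantum_proj n q (skew_partial q i ?r) = quantum_proj n q (skew_partial q i p)"
      using p by (intro quantum_proj_skew_partial_cong[OF q]) simp_all
    then show ?thesis using p by (simp add: D_def quantum_proj_closed)
  qed
  have D_closed: "D \<in> carrier ?A \<rightarrow>\<^sub>E carrier ?A"
  proof (rule PiE_I)
    fix Y assume "Y \<in> carrier ?A"
    then obtain p where "p \<in> carrier ?F" "Y = quantum_proj n q p" by (rule quantum_proj_surj)
    then show "D Y \<in> carrier ?A" by (simp add: D_proj quantum_proj_closed skew_partial_carrier)
  qed (simp add: D_def)
  have D_linear: "linear_map ?A ?A D"
    unfolding linear_map_def
  proof (intro conjI ballI)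
    show "D \<in> carrier ?A \<rightarrow> carrier ?A" using D_closed by blast
  next
    fix Y Z assume "Y \<in> carrier ?A" "Z \<in> carrier ?A"
    then obtain p r where p: "p \<in> carrier ?F" "Y = quantum_proj n q p"
      and r: "r \<in> carrier ?F" "Z = quantum_proj n q r" by (metis quantum_proj_surj)
    have "D (Y \<oplus>\<^bsub>?A\<^esub> Z) = quantum_proj n q (skew_partial q i (p + r))"
      using p r D_proj[OF free_algebra_add_closed[of p n r]] by (simp add: quantum_proj_add)
    also have "\<dots> = D Y \<oplus>\<^bsub>?A\<^esub> D Z"
      using p r by (simp add: D_proj skew_partial_carrier flip: quantum_proj_add)
        (simp add: skew_partial_def linear_extension_add)
    finally show "D (Y \<oplus>\<^bsub>?A\<^esub> Z) = D Y \<oplus>\<^bsub>?A\<^esub> D Z" .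
  next
    fix c Y assume "Y \<in> carrier ?A"
    then obtain p where p: "p \<in> carrier ?F" "Y = quantum_proj n q p" by (rule quantum_proj_surj)
    have "D (c \<odot>\<^bsub>?A\<^esub> Y) = quantum_proj n q (skew_partial q i (nc_const c * p))"
      using p D_proj[OF free_algebra_mult_closed[OF nc_const_carrier[of c n], of p]]
      by (simp add: quantum_proj_const_mult)
    also have "\<dots> = c \<odot>\<^bsub>?A\<^esub> D Y"
      using p by (simp add: D_proj skew_partial_carrier flip: quantum_proj_const_mult)
        (simp add: skew_partial_def linear_extension_const_mult)
    finally show "D (c \<odot>\<^bsub>?A\<^esub> Y) = c \<odot>\<^bsub>?A\<^esub> D Y" .
  qed
  have D_monomial: "D (quantum_monomial n q \<alpha>) =
      (eta n q (\<lambda>j. if j < i then \<alpha> j else 0) (unit_vec i) * of_int (\<alpha> i))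
        \<odot>\<^bsub>?A\<^esub> quantum_monomial n q (\<lambda>j. \<alpha> j - unit_vec i j)"
    if \<alpha>: "\<forall>j\<in>{1..n}. 0 \<le> \<alpha> j" for \<alpha>
  proof -
    let ?k = "\<lambda>j. nat (\<alpha> j)" and ?\<eta> = "eta n q (\<lambda>j. if j < i then \<alpha> j else 0) (unit_vec i)"
    let ?w = "blocks (?k(i := ?k i - 1)) [1..<Suc n]"
    have w: "word ?w \<in> carrier ?F" "word (blocks ?k [1..<Suc n]) \<in> carrier ?F"
      by (intro word_carrier blocks_in_lists; auto)+
    have "(\<Sum>j=1..<i. (int i - int j) * int (?k j)) = (\<Sum>j=1..<i. (int i - int j) * \<alpha> j)"
      using \<alpha> i by (intro sum.cong) auto
    then have "eta n q (\<lambda>j. if j < i then int (?k j) else 0) (unit_vec i) = ?\<eta>"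
      unfolding eta_initial_segment[OF i] by (simp only:)
    moreover have "of_nat (?k i) = (of_int (\<alpha> i) :: complex)" using \<alpha> i by simp
    ultimately have "word_partial q i (blocks ?k [1..<Suc n]) =
        nc_const (?\<eta> * of_int (\<alpha> i)) * word ?w"
      by (simp only: word_partial_blocks[OF q i])
    moreover have "skew_partial q i (word v) = word_partial q i v" for v
      by (simp add: skew_partial_def linear_extension_single nc_const_1)
    ultimately have D: "D (quantum_monomial n q \<alpha>) = (?\<eta> * of_int (\<alpha> i)) \<odot>\<^bsub>?A\<^esub> quantum_proj n q (word ?w)"
      by (simp only: quantum_monomial_eq_blocks[OF \<alpha>] D_proj[OF w(2)] quantum_proj_const_mult[OF w(1)])
    show ?thesis
    proof (cases "\<alpha> i = 0")
      case True
      interpret complex_algebra ?A by (rule complex_algebra_quantum_space)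
      \<comment> \<open>Both sides vanish: the exponent of \<open>x\<^sub>i\<close> on the right is \<open>-1\<close>.\<close>
      have "\<not> (\<forall>j\<in>{1..n}. 0 \<le> \<alpha> j - unit_vec i j)"
        using True i by (auto simp: unit_vec_def)
      then have "quantum_monomial n q (\<lambda>j. \<alpha> j - unit_vec i j) = \<zero>\<^bsub>?A\<^esub>"
        unfolding quantum_monomial_def by (rule if_not_P)
      moreover have "0 \<odot>\<^bsub>?A\<^esub> Y = \<zero>\<^bsub>?A\<^esub>" if "Y \<in> carrier ?A" for Y
        using smult_l_null[OF that] by (simp add: ring_of_type_algebra_def)
      ultimately show ?thesis using D True quantum_proj_closed[OF w(1)] by simp
    next
      case False
      then have pos: "\<forall>j\<in>{1..n}. 0 \<le> \<alpha> j - unit_vec i j"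
        using \<alpha> i by (force simp: unit_vec_def)
      have "(\<lambda>j. nat (\<alpha> j - unit_vec i j)) = ?k(i := ?k i - 1)"
        by (auto simp: unit_vec_def fun_eq_iff nat_diff_distrib')
      then show ?thesis by (simp only: D quantum_monomial_eq_blocks[OF pos])
    qed
  qed
  have "quantum_partial n q i = D"
    unfolding quantum_partial_def
  proof (rule the_equality)
    fix E assume E: "E \<in> carrier ?A \<rightarrow>\<^sub>E carrier ?A \<and> linear_map ?A ?A E \<and>
       (\<forall>\<alpha>. (\<forall>j\<in>{1..n}. 0 \<le> \<alpha> j) \<longrightarrow>
          E (quantum_monomial n q \<alpha>) =
            (eta n q (\<lambda>j. if j < i then \<alpha> j else 0) (unit_vec i) * of_int (\<alpha> i))
              \<odot>\<^bsub>?A\<^esub> quantum_monomial n q (\<lambda>j. \<alpha> j - unit_vec i j))"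
    note E_closed = conjunct1[OF E] and E_linear = conjunct1[OF conjunct2[OF E]]
      and E_monomial = conjunct2[OF conjunct2[OF E], rule_format]
    have "E Y = D Y" if "Y \<in> carrier ?A" for Y
      by (rule linear_map_eq_on_monomials[OF E_linear D_linear _ that])
        (simp only: E_monomial D_monomial)
    then show "E = D" by (rule PiE_ext[OF E_closed D_closed])
  qed (intro conjI allI impI D_closed D_linear D_monomial)
  then show "linear_map ?A ?A (quantum_partial n q i)"
    and "p \<in> carrier ?F \<Longrightarrow>
      quantum_partial n q i (quantum_proj n q p) = quantum_proj n q (skew_partial q i p)"
    using D_linear D_proj by simp_all
qed

section \<open>The calculus on quantum space\<close>

text \<open>
  The elements \<open>p\<close> with this property contain the scalars and, by the bimodule relations, the
  letters; they are closed under sums and products as \<open>\<sigma>\<^sub>i\<close> is multiplicative.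
\<close>

lemma quantum_proj_lact_basis:
  fixes \<Omega> :: "(complex, ncpoly set, 'm) bimodule"
  assumes "complex_bimodule (quantum_space n q) \<Omega>"
    and u: "u \<in> carrier \<Omega>" and i: "i \<in> {1..n}"
    and rel: "\<And>j. j \<in> {1..n} \<Longrightarrow> quantum_gen n q j \<triangleright>\<^bsub>\<Omega>\<^esub> u =
      eta n q (unit_vec j) (unit_vec i) \<odot>\<^bsub>\<Omega>\<^esub> (u \<triangleleft>\<^bsub>\<Omega>\<^esub> quantum_gen n q j)"
    and p: "p \<in> carrier (free_algebra n)"
  shows "quantum_proj n q p \<triangleright>\<^bsub>\<Omega>\<^esub> u = u \<triangleleft>\<^bsub>\<Omega>\<^esub> quantum_proj n q (rescale q i p)"
proof -
  let ?A = "quantum_space n q"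
  interpret complex_bimodule ?A \<Omega> by fact
  have scalar: "c \<in> carrier \<bbbC>" for c by (simp add: ring_of_type_algebra_def)
  show ?thesis
    using p
  proof (induction p rule: free_algebra_induct)
    case (const c)
    have "rescale q i (nc_const c) = nc_const c"
      by (simp add: rescale_def nc_const_def linear_extension_single mult_single plus_list_def)
    moreover have "quantum_proj n q (nc_const c) = c \<odot>\<^bsub>?A\<^esub> \<one>\<^bsub>?A\<^esub>"
    proof -
      have "1 \<in> carrier (free_algebra n)" by (metis nc_const_1 nc_const_carrier)
      from quantum_proj_const_mult[OF this, of q c] show ?thesis by (simp add: quantum_proj_one)
    qed
    ultimately show ?case
      using u by (simp add: scalar lact_smult ract_smult lact_one ract_one)
  next
    case (var j)
    have "quantum_proj n q (rescale q i (nc_var j)) =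
        eta n q (unit_vec j) (unit_vec i) \<odot>\<^bsub>?A\<^esub> quantum_gen n q j"
      unfolding eta_unit_vec_unit_vec[OF var i] rescale_nc_var quantum_gen_eq_proj
      by (rule quantum_proj_const_mult[OF nc_var_carrier[OF var]])
    moreover have "quantum_gen n q j \<in> carrier ?A"
      unfolding quantum_gen_eq_proj by (rule quantum_proj_closed[OF nc_var_carrier[OF var]])
    ultimately show ?case
      using rel[OF var] u by (simp add: scalar ract_smult flip: quantum_gen_eq_proj)
  next
    case (add p r)
    have "rescale q i (p + r) = rescale q i p + rescale q i r"
      by (simp add: rescale_def linear_extension_add)
    then show ?case
      using add u by (simp add: quantum_proj_add quantum_proj_closed rescale_carrier
          lact_add_left ract_add_right)
  next
    case (mult p r)
    have "quantum_proj n q (p * r) \<triangleright>\<^bsub>\<Omega>\<^esub> u =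
        quantum_proj n q p \<triangleright>\<^bsub>\<Omega>\<^esub> (u \<triangleleft>\<^bsub>\<Omega>\<^esub> quantum_proj n q (rescale q i r))"
      using mult u by (simp add: quantum_proj_mult quantum_proj_closed lact_mult)
    also have "\<dots> = (u \<triangleleft>\<^bsub>\<Omega>\<^esub> quantum_proj n q (rescale q i p)) \<triangleleft>\<^bsub>\<Omega>\<^esub> quantum_proj n q (rescale q i r)"
      using mult u by (simp add: quantum_proj_closed rescale_carrier flip: lact_ract)
    also have "\<dots> = u \<triangleleft>\<^bsub>\<Omega>\<^esub> quantum_proj n q (rescale q i (p * r))"
      using mult u by (simp add: quantum_proj_mult quantum_proj_closed rescale_carrier rescale_mult
          ract_mult)
    finally show ?case .
  qed
qed

theorem theorem4p2:
  fixes n :: nat and q :: complex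
    and \<Omega> :: "(complex, ncpoly set, 'm) bimodule"
    and dx :: "nat \<Rightarrow> 'm"
    and d :: "ncpoly set \<Rightarrow> 'm"
  assumes "n \<ge> 1" and "q \<noteq> 0"
    and "complex_bimodule (quantum_space n q) \<Omega>"
    and "right_module_basis (quantum_space n q) \<Omega> {1..n} dx"
    and "\<And>i j. i \<in> {1..n} \<Longrightarrow> j \<in> {1..n} \<Longrightarrow>
      quantum_gen n q i \<triangleright>\<^bsub>\<Omega>\<^esub> dx j =
        eta n q (unit_vec i) (unit_vec j) \<odot>\<^bsub>\<Omega>\<^esub> (dx j \<triangleleft>\<^bsub>\<Omega>\<^esub> quantum_gen n q i)"
    and "\<And>f. f \<in> carrier (quantum_space n q) \<Longrightarrow>
      d f = (\<Oplus>\<^bsub>\<Omega>\<^esub>i\<in>{1..n}. dx i \<triangleleft>\<^bsub>\<Omega>\<^esub> quantum_partial n q i f)"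
  shows "first_order_differential_calculus (quantum_space n q) \<Omega> d"
proof -
  let ?A = "quantum_space n q" and ?F = "free_algebra n"
  note partial_proj = quantum_partial_proj_and_linear(1)[OF assms(2)]
  define lift where "lift Y = (SOME p. p \<in> carrier ?F \<and> Y = quantum_proj n q p)" for Y
  \<comment> \<open>The endomorphism \<open>\<sigma>\<^sub>i\<close> of quantum space, computed on a chosen representative.\<close>
  define \<tau> where "\<tau> i Y = quantum_proj n q (rescale q i (lift Y))" for i Y
  have lift: "lift Y \<in> carrier ?F" "quantum_proj n q (lift Y) = Y" if Y: "Y \<in> carrier ?A" for Y
  proof -
    have "\<exists>p. p \<in> carrier ?F \<and> Y = quantum_proj n q p"
      by (rule quantum_proj_surj[OF Y], rule exI, rule conjI)
    from someI_ex[OF this] have "lift Y \<in> carrier ?F \<and> Y = quantum_proj n q (lift Y)"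
      unfolding lift_def .
    then show "lift Y \<in> carrier ?F" "quantum_proj n q (lift Y) = Y" by simp_all
  qed
  show ?thesis
  proof (rule complex_bimodule.calculus_of_skew_derivations[OF assms(3) _ assms(4)])
    fix i Y assume i: "i \<in> {1..n}" and Y: "Y \<in> carrier ?A"
    show "\<tau> i Y \<in> carrier ?A"
      unfolding \<tau>_def by (intro quantum_proj_closed rescale_carrier lift Y)
    have "dx i \<in> carrier \<Omega>" using assms(4) i unfolding right_module_basis_def by blast
    from quantum_proj_lact_basis[OF assms(3) this i assms(5)[OF _ i] lift(1)[OF Y]]
    show "Y \<triangleright>\<^bsub>\<Omega>\<^esub> dx i = dx i \<triangleleft>\<^bsub>\<Omega>\<^esub> \<tau> i Y" by (simp add: \<tau>_def lift Y)
    fix Z assume Z: "Z \<in> carrier ?A"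
    have carr: "lift Y \<in> carrier ?F" "lift Z \<in> carrier ?F" using lift Y Z by simp_all
    have "quantum_partial n q i (Y \<otimes>\<^bsub>?A\<^esub> Z) = quantum_partial n q i (quantum_proj n q (lift Y * lift Z))"
      using Y Z carr by (simp add: quantum_proj_mult lift)
    also have "\<dots> = quantum_proj n q
        (skew_partial q i (lift Y) * lift Z + rescale q i (lift Y) * skew_partial q i (lift Z))"
      by (simp add: partial_proj[OF i] free_algebra_mult_closed carr skew_partial_mult)
    also have "\<dots> = (quantum_partial n q i (quantum_proj n q (lift Y)) \<otimes>\<^bsub>?A\<^esub> quantum_proj n q (lift Z))
        \<oplus>\<^bsub>?A\<^esub> (\<tau> i Y \<otimes>\<^bsub>?A\<^esub> quantum_partial n q i (quantum_proj n q (lift Z)))"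
      by (simp add: partial_proj[OF i] \<tau>_def carr quantum_proj_add quantum_proj_mult
          free_algebra_mult_closed skew_partial_carrier rescale_carrier)
    finally show "quantum_partial n q i (Y \<otimes>\<^bsub>?A\<^esub> Z) =
        (quantum_partial n q i Y \<otimes>\<^bsub>?A\<^esub> Z) \<oplus>\<^bsub>?A\<^esub> (\<tau> i Y \<otimes>\<^bsub>?A\<^esub> quantum_partial n q i Z)"
      by (simp add: lift Y Z)
  next
    fix i assume i: "i \<in> {1..n}"
    show "linear_map ?A ?A (quantum_partial n q i)"
      by (rule quantum_partial_proj_and_linear(2)[OF assms(2) i])
    show "quantum_gen n q i \<in> carrier ?A"
      unfolding quantum_gen_eq_proj by (rule quantum_proj_closed[OF nc_var_carrier[OF i]])
    fix j assume j: "j \<in> {1..n}"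
    show "quantum_partial n q i (quantum_gen n q j) = (if i = j then \<one>\<^bsub>?A\<^esub> else \<zero>\<^bsub>?A\<^esub>)"
      unfolding quantum_gen_eq_proj partial_proj[OF i nc_var_carrier[OF j]] skew_partial_nc_var
      by (simp add: quantum_proj_one quantum_proj_zero)
  qed (simp_all add: assms(6))
qed

end
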